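(* For every positive integer $d$ and every $\alpha\ge1$, the class $\mathcal{C}^d_\alpha$ has asymptotic dimension at most $2d+2$.
   Context: The height of a bounded convex set $X\subseteq\mathbb{R}^d$ is the infimum of $h\ge0$ such that $X$ lies between two parallel hyperplanes at distance $h$; its aspect ratio is its diameter divided by its height. $\mathcal{C}^d_\alpha$ is the class of connected (finite) intersection graphs of systems of path-connected sets in $\mathbb{R}^d$, each of which is obtained from a compact convex set of aspect ratio at most $\alpha$ by removing some subset of its interior. For a graph with shortest-path metric, a family $\mathcal U$ of vertex sets is $D$-bounded if each member has diameter at most $D$, and $r$-disjoint if vertices in different members are at distance $>r$. An $n$-dimensional control function for a class $\mathcal C$ is $D:\mathbb{R}_+\to\mathbb{R}_+$ such that for all $G\in\mathcal C$ and $r>0$, $V(G)$ has a cover $\bigcup_{i=1}^{n+1}\mathcal U_i$ with each $\mathcal U_i$ $r$-disjoint and all members $D(r)$-bounded; the asymptotic dimension of $\mathcal C$ is the least such $n$. *)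

theory Defs
  imports "HOL-Analysis.Analysis"
begin

definition height :: "'a::euclidean_space set \<Rightarrow> real" where
  "height X = Inf {h. h \<ge> 0 \<and> (\<exists>u c. norm u = 1 \<and>
       (\<forall>x\<in>X. c \<le> u \<bullet> x \<and> u \<bullet> x \<le> c + h))}"

text \<open>Aspect ratio at most alpha, i.e. diameter / height \<le> alpha, written
multiplicatively (so that a single point, with 0/0, counts as admissible).\<close>
definition aspect_ratio_le :: "'a::euclidean_space set \<Rightarrow> real \<Rightarrow> bool" where
  "aspect_ratio_le X \<alpha> \<longleftrightarrow> bounded X \<and> diameter X \<le> \<alpha> * height X"

definition is_walk :: "nat set \<Rightarrow> (nat \<Rightarrow> nat \<Rightarrow> bool) \<Rightarrow> nat \<Rightarrow> nat \<Rightarrow> nat \<Rightarrow> bool" where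
  "is_walk V E u v n \<longleftrightarrow> (\<exists>p :: nat \<Rightarrow> nat. p 0 = u \<and> p n = v \<and> (\<forall>i\<le>n. p i \<in> V) \<and>
       (\<forall>i<n. E (p i) (p (Suc i))))"

definition graph_connected :: "nat set \<Rightarrow> (nat \<Rightarrow> nat \<Rightarrow> bool) \<Rightarrow> bool" where
  "graph_connected V E \<longleftrightarrow> (\<forall>u\<in>V. \<forall>v\<in>V. \<exists>n. is_walk V E u v n)"

text \<open>Shortest-path distance (used only for connected graphs).\<close>
definition gdist :: "nat set \<Rightarrow> (nat \<Rightarrow> nat \<Rightarrow> bool) \<Rightarrow> nat \<Rightarrow> nat \<Rightarrow> real" where
  "gdist V E u v = real (LEAST n. is_walk V E u v n)"

definition D_bounded :: "nat set \<Rightarrow> (nat \<Rightarrow> nat \<Rightarrow> bool) \<Rightarrow> real \<Rightarrow> nat set set \<Rightarrow> bool" where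
  "D_bounded V E D \<U> \<longleftrightarrow> (\<forall>U\<in>\<U>. \<forall>x\<in>U. \<forall>y\<in>U. gdist V E x y \<le> D)"

definition r_disjoint :: "nat set \<Rightarrow> (nat \<Rightarrow> nat \<Rightarrow> bool) \<Rightarrow> real \<Rightarrow> nat set set \<Rightarrow> bool" where
  "r_disjoint V E r \<U> \<longleftrightarrow>
     (\<forall>U\<in>\<U>. \<forall>W\<in>\<U>. U \<noteq> W \<longrightarrow> (\<forall>x\<in>U. \<forall>y\<in>W. gdist V E x y > r))"

definition control_function ::
    "(nat set \<Rightarrow> (nat \<Rightarrow> nat \<Rightarrow> bool) \<Rightarrow> bool) \<Rightarrow> nat \<Rightarrow> (real \<Rightarrow> real) \<Rightarrow> bool" where
  "control_function C n D \<longleftrightarrow> (\<forall>r>0. D r > 0) \<and>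
     (\<forall>V E. C V E \<longrightarrow> (\<forall>r>0. \<exists>\<U> :: nat \<Rightarrow> nat set set.
        V = (\<Union>i\<le>n. \<Union>(\<U> i)) \<and>
        (\<forall>i\<le>n. r_disjoint V E r (\<U> i) \<and> D_bounded V E (D r) (\<U> i))))"

definition asdim_le :: "(nat set \<Rightarrow> (nat \<Rightarrow> nat \<Rightarrow> bool) \<Rightarrow> bool) \<Rightarrow> nat \<Rightarrow> bool" where
  "asdim_le C n \<longleftrightarrow> (\<exists>D. control_function C n D)"

definition in_class_C :: "'a::euclidean_space itself \<Rightarrow> real \<Rightarrow> nat set \<Rightarrow> (nat \<Rightarrow> nat \<Rightarrow> bool) \<Rightarrow> bool" where
  "in_class_C _ \<alpha> V E \<longleftrightarrow> finite V \<and> graph_connected V E \<and>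
     (\<exists>S K R :: nat \<Rightarrow> 'a set.
        (\<forall>v\<in>V. compact (K v) \<and> convex (K v) \<and> aspect_ratio_le (K v) \<alpha> \<and>
               R v \<subseteq> interior (K v) \<and> S v = K v - R v \<and> path_connected (S v)) \<and>
        (\<forall>u\<in>V. \<forall>v\<in>V. E u v \<longleftrightarrow> u \<noteq> v \<and> S u \<inter> S v \<noteq> {}))"

end

theory Submission
  imports Defs
begin

text \<open>
  Let \<open>f\<close> be the distance from a root of the graph. By a Hurewicz-type argument it costs one
  colour to pass from sets of boundedly many consecutive layers of \<open>f\<close> to the whole graph, so it
  suffices to colour such a set with \<open>2 (d + 1)\<close> colours.

  The level of a vertex is the largest scale (logarithm of the diameter) of a vertex at distance
  at most \<open>r\<close> from it. Take \<open>d + 1\<close> shifted nested cubical grids such that every point is, at each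
  scale, far from the boundary of its cell in one of them, and give the vertex the index of a grid
  in which it is deep inside its cell of the size prescribed by its level. For a fixed index
  the cells form a forest, and vertices at distance at most \<open>r\<close> have nested cells.
  A path that leaves a cell passes a set that is at least as large as the cell; within the given
  layers these sets fall into boundedly many classes of bounded diameter. Indeed, rescale them to
  the size of the cell and record which cells of a fine mesh they meet: by separation, two convex
  sets of bounded aspect ratio with the same record intersect, and if the hollow versions are
  disjoint, then one is nested in the other, which forces them to be close in the graph because
  a shortest path from the root has to cross the one in between. So each of the \<open>d + 1\<close> parts is
  coarsely a graph of bounded tree-width, and such graphs have asymptotic dimension at most 1.
\<close>

section \<open>Components at a fixed scale\<close>

text \<open>The count: \<open>2 * (d + 1)\<close> colours on a band of layers and one more for all
  layers give \<open>2 * d + 3\<close> families, hence dimension \<open>2 * d + 2\<close>. Sets that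
  overlap in space may be far apart in the graph, because hollow sets can be nested without
  touching. Only their depth controls the distance, and only if the root is on the same side of
  both; hence the restriction to few layers and one extra bit in the record of a set. The forest of
  cells can be arbitrarily deep, so nothing may be lost from one generation to the next. The
  colouring of a cell is therefore required to keep the points near its hubs as a separate block of
  the first colour. Only this block can be joined to what lies outside, so colourings of subcells
  can be inserted with the same bound. Constants grow only in the induction on the width, which is
  bounded by the number of hubs. The level is a maximum over a ball and not the size of the set
  itself: then all sets on a walk of \<open>r\<close> steps from a vertex are small against the
  padding of its cell.\<close>

text \<open>\<open>W k x y\<close> says that the distance of \<open>x\<close> and \<open>y\<close> is at most \<open>k\<close>; the distance may be infinite.\<close>

locale near_space =
  fixes W :: "nat \<Rightarrow> 'a \<Rightarrow> 'a \<Rightarrow> bool"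
  assumes near_refl: "W 0 x x"
    and near_sym: "W k x y \<Longrightarrow> W k y x"
    and near_trans: "W j x y \<Longrightarrow> W k y z \<Longrightarrow> W (j + k) x z"
    and near_mono: "W j x y \<Longrightarrow> j \<le> k \<Longrightarrow> W k x y"
begin

lemma near_le: "W i x y \<Longrightarrow> W j y z \<Longrightarrow> i + j \<le> k \<Longrightarrow> W k x z"
  using near_trans near_mono by blast

inductive conn :: "nat \<Rightarrow> 'a set \<Rightarrow> 'a \<Rightarrow> 'a \<Rightarrow> bool" for r S where
  conn_refl: "x \<in> S \<Longrightarrow> conn r S x x"
| conn_step: "conn r S x y \<Longrightarrow> z \<in> S \<Longrightarrow> W r y z \<Longrightarrow> conn r S x z"

lemma conn_in: "conn r S x y \<Longrightarrow> x \<in> S \<and> y \<in> S"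
  by (induction rule: conn.induct) auto

lemma conn_trans: "conn r S y z \<Longrightarrow> conn r S x y \<Longrightarrow> conn r S x z"
  by (induction rule: conn.induct) (auto intro: conn_step)

lemma conn_edge: "x \<in> S \<Longrightarrow> y \<in> S \<Longrightarrow> W r x y \<Longrightarrow> conn r S x y"
  by (blast intro: conn_refl conn_step)

lemma conn_sym: "conn r S x y \<Longrightarrow> conn r S y x"
proof (induction rule: conn.induct)
  case (conn_step x y z)
  have "y \<in> S" using conn_step conn_in by blast
  then have "conn r S z y" using conn_step near_sym by (blast intro: conn_edge)
  then show ?case using conn_step conn_trans by blast
qed (rule conn_refl)

lemma conn_mono: "conn r S x y \<Longrightarrow> S \<subseteq> S' \<Longrightarrow> r \<le> r' \<Longrightarrow> conn r' S' x y"
proof (induction rule: conn.induct)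
  case (conn_step x y z)
  then show ?case using near_mono by (blast intro: conn.conn_step)
qed (blast intro: conn_refl)

definition cbd :: "nat \<Rightarrow> nat \<Rightarrow> 'a set \<Rightarrow> bool" where
  "cbd r D S \<longleftrightarrow> (\<forall>x y. conn r S x y \<longrightarrow> W D x y)"

lemma cbd_mono:
  assumes "cbd r D S" "S' \<subseteq> S" "r' \<le> r" "D \<le> D'"
  shows "cbd r' D' S'"
  using assms conn_mono near_mono unfolding cbd_def by blast

text \<open>As \<open>f\<close> is constant along steps, every component lies in one fibre. Blocks
  of a colour class are thus treated separately, without adding their bounds.\<close>

lemma cbd_split:
  assumes const: "\<And>x y. x \<in> S \<Longrightarrow> y \<in> S \<Longrightarrow> W r x y \<Longrightarrow> f x = f y"
    and bd: "\<And>x. x \<in> S \<Longrightarrow> cbd r D {y \<in> S. f y = f x}"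
  shows "cbd r D S"
proof -
  have "conn r {y \<in> S. f y = f x} x y" if "conn r S x y" for x y
    using that
  proof (induction rule: conn.induct)
    case (conn_refl x)
    then show ?case by (auto intro: conn.conn_refl)
  next
    case (conn_step x y z)
    have "y \<in> S" "f y = f x" using conn_in[OF conn_step.IH] by auto
    then have "f z = f x" using const conn_step by metis
    then show ?case using conn_step by (auto intro: conn.conn_step)
  qed
  then show ?thesis using bd conn_in unfolding cbd_def by blast
qed

text \<open>A component of the union runs through \<open>B\<close> only in pieces of bounded size, and these
  pieces do not connect points of \<open>A\<close> that were not already related by \<open>Q\<close>.\<close>

lemma cbd_absorb:
  assumes B: "cbd r D2 B"
    and Qbd: "\<And>u v. Q u v \<Longrightarrow> W D3 u v"
    and Qrefl: "\<And>u. u \<in> A \<Longrightarrow> Q u u"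
    and Qtrans: "\<And>u v w. Q u v \<Longrightarrow> Q v w \<Longrightarrow> Q u w"
    and Qstep: "\<And>u v. u \<in> A \<Longrightarrow> v \<in> A \<Longrightarrow> W r u v \<Longrightarrow> Q u v"
    and Qvia: "\<And>u v b b'. u \<in> A \<Longrightarrow> v \<in> A \<Longrightarrow> W r u b \<Longrightarrow> conn r B b b' \<Longrightarrow> W r b' v \<Longrightarrow> Q u v"
  shows "cbd r (D3 + 2 * (D2 + r)) (A \<union> B)"
proof -
  have fromA: "(y \<in> A \<and> Q x y) \<or> (\<exists>u b. u \<in> A \<and> Q x u \<and> W r u b \<and> conn r B b y)"
    if "conn r (A \<union> B) x y" "x \<in> A" for x y
    using that
  proof (induction rule: conn.induct)
    case (conn_refl x)
    then show ?case using Qrefl by blast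
  next
    case (conn_step x y z)
    show ?case
    proof (cases "z \<in> A")
      case True
      then show ?thesis using conn_step Qstep Qvia Qtrans by metis
    next
      case False
      then have "z \<in> B" using conn_step by blast
      then show ?thesis using conn_step by (metis conn.conn_refl conn.conn_step)
    qed
  qed
  have fromB: "conn r B x y \<or> (\<exists>b u. conn r B x b \<and> W r b u \<and> u \<in> A \<and> conn r (A \<union> B) u y)"
    if "conn r (A \<union> B) x y" "x \<in> B" for x y
    using that
  proof (induction rule: conn.induct)
    case (conn_refl x)
    then show ?case using conn.conn_refl by blast
  next
    case (conn_step x y z)
    then show ?case by (metis UnE UnI1 conn.conn_refl conn.conn_step)
  qed
  have A: "W (D3 + r + D2) x y" if "conn r (A \<union> B) x y" "x \<in> A" for x y
  proof -
    from fromA[OF that] show ?thesis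
    proof
      assume "y \<in> A \<and> Q x y"
      then show ?thesis using Qbd near_mono by (metis add.assoc le_add1)
    next
      assume "\<exists>u b. u \<in> A \<and> Q x u \<and> W r u b \<and> conn r B b y"
      then obtain u b where "Q x u" "W r u b" "conn r B b y" by blast
      then show ?thesis using Qbd B near_trans unfolding cbd_def by blast
    qed
  qed
  show ?thesis unfolding cbd_def
  proof (intro allI impI)
    fix x y assume c: "conn r (A \<union> B) x y"
    show "W (D3 + 2 * (D2 + r)) x y"
    proof (cases "x \<in> A")
      case True
      then show ?thesis using A[OF c] by (auto elim: near_mono)
    next
      case False
      then have xB: "x \<in> B" using c conn_in by blast
      from fromB[OF c xB] show ?thesis
      proof
        assume "conn r B x y"
        then show ?thesis using B near_mono[of D2 x y] unfolding cbd_def by auto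
      next
        assume "\<exists>b u. conn r B x b \<and> W r b u \<and> u \<in> A \<and> conn r (A \<union> B) u y"
        then obtain b u where *: "conn r B x b" "W r b u" "u \<in> A" "conn r (A \<union> B) u y" by blast
        have "W (D2 + r) x u" using * B near_trans unfolding cbd_def by blast
        then have "W ((D2 + r) + (D3 + r + D2)) x y" using A[OF *(4,3)] near_trans by blast
        then show ?thesis by (auto elim: near_mono)
      qed
    qed
  qed
qed

text \<open>A detour through one component of \<open>B\<close> has length at most
  \<open>r + D2 + r\<close>, so it is a single step at scale \<open>rr\<close>. This is why
  colourings are requested inductively at scales larger than \<open>r\<close>.\<close>

lemma cbd_absorb_far:
  assumes B: "cbd r D2 B" and A: "cbd rr D3 A" and rr: "D2 + 2 * r \<le> rr"
  shows "cbd r (D3 + 2 * (D2 + r)) (A \<union> B)"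
proof (rule cbd_absorb[OF B, where Q = "conn rr A"])
  fix u v b b' assume *: "u \<in> A" "v \<in> A" "W r u b" "conn r B b b'" "W r b' v"
  have "W (r + D2 + r) u v" using * B near_trans unfolding cbd_def by blast
  then have "W rr u v" using rr by (auto elim: near_mono)
  then show "conn rr A u v" using * conn_edge by blast
next
  fix u v assume "u \<in> A" "v \<in> A" "W r u v"
  moreover have "r \<le> rr" using rr by simp
  ultimately show "conn rr A u v" using conn_edge near_mono by blast
qed (use A conn_trans conn.conn_refl in \<open>auto simp: cbd_def\<close>)

end

fun nbd :: "nat \<Rightarrow> nat \<Rightarrow> nat \<Rightarrow> nat" where
  "nbd \<rho> r 0 = 0"
| "nbd \<rho> r (Suc n) = 2 * \<rho> + 2 * (nbd \<rho> r n + r)"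

lemma nbd_mono: "m \<le> n \<Longrightarrow> nbd \<rho> r m \<le> nbd \<rho> r n"
proof (induction n)
  case (Suc n)
  then show ?case by (cases "m = Suc n") (fastforce simp: le_Suc_eq)+
qed simp

context near_space begin

text \<open>Hubs are split off one at a time. The points around one hub have mutual distance at most
  \<open>2 * \<rho>\<close>, so the total relation on them serves as \<open>Q\<close>, whatever the
  other components connect.\<close>

lemma cbd_near_finite:
  assumes "finite F" "card F \<le> n" "\<And>x. x \<in> S \<Longrightarrow> \<exists>z\<in>F. W \<rho> x z"
  shows "cbd r (nbd \<rho> r n) S"
proof -
  have "cbd r (nbd \<rho> r (card F)) S"
    using assms(1,3)
  proof (induction arbitrary: S rule: finite_induct)
    case empty
    then have "S = {}" by auto
    then show ?case using conn_in by (auto simp: cbd_def)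
  next
    case (insert z F)
    define A where "A = {x \<in> S. W \<rho> x z}"
    have B: "cbd r (nbd \<rho> r (card F)) (S - A)"
      by (rule insert.IH) (use insert.prems in \<open>auto simp: A_def\<close>)
    have "cbd r (2 * \<rho> + 2 * (nbd \<rho> r (card F) + r)) (A \<union> (S - A))"
    proof (rule cbd_absorb[OF B, where Q = "\<lambda>u v. u \<in> A \<and> v \<in> A"])
      fix u v assume "u \<in> A \<and> v \<in> A"
      then have "W (\<rho> + \<rho>) u v" unfolding A_def using near_trans near_sym by blast
      then show "W (2 * \<rho>) u v" by (simp add: mult_2)
    qed auto
    moreover have "A \<union> (S - A) = S" by (auto simp: A_def)
    ultimately show ?case using insert by simp
  qed
  then show ?thesis by (rule cbd_mono[OF _ _ _ nbd_mono[OF assms(2)]]) auto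
qed

end

section \<open>Two colours for tree-like spaces\<close>

text \<open>Length of a step that jumps over an \<open>r\<close>-component of the
  \<open>2 * r + 1\<close>-neighbourhood of the hubs of one set: the diameter of the component and a
  step of length \<open>r\<close> at either end.\<close>

definition tree_jump :: "nat \<Rightarrow> nat \<Rightarrow> nat" where
  "tree_jump N r = nbd (2 * r + 1) r N + 2 * r"

text \<open>The distance from \<open>Y\<close> up to which hubs are counted. The increment is what
  \<open>rest_width\<close> uses:
  \<open>(R' + 1) + (3 * r + 2) + (3 * r + 1) = R' + 6 * r + 4\<close>.\<close>

fun tree_range :: "nat \<Rightarrow> nat \<Rightarrow> nat \<Rightarrow> nat \<Rightarrow> nat" where
  "tree_range N 0 r \<beta> = r"
| "tree_range N (Suc n) r \<beta> = tree_range N n (tree_jump N r) (max \<beta> (r + 1)) + 6 * r + 4"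

fun tree_bound :: "nat \<Rightarrow> nat \<Rightarrow> nat \<Rightarrow> nat \<Rightarrow> nat" where
  "tree_bound N 0 r \<beta> =
     nbd (max \<beta> (r + 1)) (nbd \<beta> r N + 2 * r) N + 2 * (nbd \<beta> r N + r)"
| "tree_bound N (Suc n) r \<beta> =
     (let D = tree_bound N n (tree_jump N r) (max \<beta> (r + 1));
          q = nbd (2 * r + 1) r N
      in q + (D + 2 * (q + r)) + (nbd (tree_range N (Suc n) r \<beta>) (D + 2 * r) N + 2 * (D + r)))"

text \<open>A coarse tree decomposition: the members of \<L> are the parts below the nodes of a
  forest and \<open>F L\<close> is the bag of the top node of \<open>L\<close>. A walk that leaves
  \<open>L\<close> comes close to this bag and also to the bag of the parent.\<close>

locale tree_space = near_space W
  for W :: "nat \<Rightarrow> 'a \<Rightarrow> 'a \<Rightarrow> bool" +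
  fixes \<L> :: "'a set set" and F :: "'a set \<Rightarrow> 'a set" and N :: nat
  assumes finite_L: "finite \<L>"
    and laminar: "L \<in> \<L> \<Longrightarrow> M \<in> \<L> \<Longrightarrow> L \<subseteq> M \<or> M \<subseteq> L \<or> L \<inter> M = {}"
    and finite_F: "L \<in> \<L> \<Longrightarrow> finite (F L)"
    and card_F: "L \<in> \<L> \<Longrightarrow> card (F L) \<le> N"
    and F_core: "L \<in> \<L> \<Longrightarrow> M \<in> \<L> \<Longrightarrow> M \<subset> L \<Longrightarrow> F L \<inter> M = {}"
    and separates: "L \<in> \<L> \<Longrightarrow> x \<in> L \<Longrightarrow> y \<notin> L \<Longrightarrow> W k x y \<Longrightarrow> \<exists>z\<in>F L. W (k + 1) x z"
    and separates_parent: "L \<in> \<L> \<Longrightarrow> M \<in> \<L> \<Longrightarrow> L \<subset> M \<Longrightarrow> (\<And>J. J \<in> \<L> \<Longrightarrow> L \<subset> J \<Longrightarrow> \<not> J \<subset> M) \<Longrightarrow>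
        x \<in> L \<Longrightarrow> y \<notin> L \<Longrightarrow> W k x y \<Longrightarrow> \<exists>z\<in>F M. W (k + 1) x z"
begin

definition child :: "'a set \<Rightarrow> 'a set \<Rightarrow> bool" where
  "child K t \<longleftrightarrow> K \<in> \<L> \<and> t \<in> \<L> \<and> K \<subset> t \<and> (\<forall>J\<in>\<L>. K \<subset> J \<longrightarrow> \<not> J \<subset> t)"

definition nearF :: "nat \<Rightarrow> 'a set \<Rightarrow> 'a set" where
  "nearF k L = {x. \<exists>z\<in>F L. W k x z}"

lemma nearF_mono: "x \<in> nearF j L \<Longrightarrow> j \<le> k \<Longrightarrow> x \<in> nearF k L"
  unfolding nearF_def using near_mono by blast

lemma nearF_step: "x \<in> nearF j L \<Longrightarrow> W r x y \<Longrightarrow> j + r \<le> k \<Longrightarrow> y \<in> nearF k L"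
proof -
  assume "x \<in> nearF j L" "W r x y" "j + r \<le> k"
  then obtain z where "z \<in> F L" "W j x z" "W r y x" unfolding nearF_def using near_sym by auto
  then have "W k y z" using near_le[of r y x j z k] \<open>j + r \<le> k\<close> by simp
  then show ?thesis using \<open>z \<in> F L\<close> unfolding nearF_def by auto
qed

lemma separates_nearF: "L \<in> \<L> \<Longrightarrow> x \<in> L \<Longrightarrow> y \<notin> L \<Longrightarrow> W k x y \<Longrightarrow> x \<in> nearF (k + 1) L"
  unfolding nearF_def using separates[of L x y k] by auto

lemma separates_child: "child K t \<Longrightarrow> x \<in> K \<Longrightarrow> y \<notin> K \<Longrightarrow> W k x y \<Longrightarrow> x \<in> nearF (k + 1) t"
  unfolding nearF_def child_def using separates_parent[of K t x y k] by auto

lemma cbd_nearF: "L \<in> \<L> \<Longrightarrow> S \<subseteq> nearF \<rho> L \<Longrightarrow> cbd r (nbd \<rho> r N) S"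
  by (rule cbd_near_finite[OF finite_F card_F]) (auto simp: nearF_def)

text \<open>\<open>T\<close> is what remains of the forest under \<open>L0\<close> when whole
  subtrees are pruned, hence the upward closure.\<close>

definition instance_on :: "'a set \<Rightarrow> 'a set set \<Rightarrow> 'a set \<Rightarrow> bool" where
  "instance_on L0 T Y \<longleftrightarrow> L0 \<in> T \<and> T \<subseteq> \<L> \<and> (\<forall>L\<in>T. L \<subseteq> L0) \<and>
     (\<forall>L\<in>T. \<forall>M\<in>\<L>. L \<subseteq> M \<longrightarrow> M \<subseteq> L0 \<longrightarrow> M \<in> T) \<and> Y \<subseteq> L0"

text \<open>Only the hubs close to \<open>Y\<close> count, so the width drops when the surroundings of a hub are removed
  from \<open>Y\<close>.\<close>

definition width_le :: "nat \<Rightarrow> nat \<Rightarrow> 'a set set \<Rightarrow> 'a set \<Rightarrow> bool" where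
  "width_le n R T Y \<longleftrightarrow> (\<forall>L\<in>T. card {z \<in> F L. \<exists>x\<in>Y \<inter> L. W (R + 1) x z} \<le> n)"

text \<open>After pruning, a point may survive in a removed set \<open>K\<close>. It must then be
  near the hubs of \<open>K\<close>, or of the smallest remaining set \<open>t\<close> around it,
  with \<open>K\<close> directly under \<open>t\<close>.\<close>

definition covered :: "nat \<Rightarrow> 'a set set \<Rightarrow> 'a set \<Rightarrow> bool" where
  "covered \<beta> T Y \<longleftrightarrow> (\<forall>x\<in>Y. \<exists>t\<in>T. x \<in> t \<and> (\<forall>L\<in>T. x \<in> L \<longrightarrow> t \<subseteq> L) \<and>
     (x \<in> nearF \<beta> t \<or> (\<exists>K. child K t \<and> K \<notin> T \<and> x \<in> K \<and> x \<in> nearF \<beta> K)))"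

lemma coveredE:
  assumes "covered \<beta> T Y" "x \<in> Y"
  obtains t where "t \<in> T" "x \<in> t" "\<And>L. L \<in> T \<Longrightarrow> x \<in> L \<Longrightarrow> t \<subseteq> L"
    "x \<in> nearF \<beta> t \<or> (\<exists>K. child K t \<and> K \<notin> T \<and> x \<in> K \<and> x \<in> nearF \<beta> K)"
proof -
  obtain t where "t \<in> T" "x \<in> t \<and> (\<forall>L\<in>T. x \<in> L \<longrightarrow> t \<subseteq> L) \<and>
     (x \<in> nearF \<beta> t \<or> (\<exists>K. child K t \<and> K \<notin> T \<and> x \<in> K \<and> x \<in> nearF \<beta> K))"
    using assms(1)[unfolded covered_def, rule_format, OF assms(2)] by (elim bexE)
  then show ?thesis by (intro that[of t]) auto
qed

lemma child_disjoint:
  assumes "child K t" "child K' t" "x \<in> K" "x \<in> K'"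
  shows "K = K'"
  using assms laminar[of K K'] unfolding child_def by blast

text \<open>With width 0 no hub of a set in \<open>T\<close> is within \<open>r + 1\<close> of the
  points of \<open>Y\<close> inside that set, so no step of length \<open>r\<close> crosses it. A
  component therefore belongs to one node \<open>t\<close> and its children, and a step out of a
  child starts near the hubs of \<open>t\<close>.\<close>

lemma tree_base:
  assumes inst: "instance_on L0 T Y" and wid: "width_le 0 r T Y" and cov: "covered \<beta> T Y"
  shows "cbd r (tree_bound N 0 r \<beta>) Y"
proof (rule cbd_split[where f = "\<lambda>x. {L \<in> T. x \<in> L}"])
  have TL: "T \<subseteq> \<L>" using inst by (auto simp: instance_on_def)
  have no_cross: "y \<in> L" if x: "L \<in> T" "x \<in> Y" "x \<in> L" "W r x y" for L x y
  proof (rule ccontr)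
    assume "y \<notin> L"
    then obtain z where z: "z \<in> F L" "W (r + 1) x z" using separates[of L x y r] x TL by blast
    have "finite {z \<in> F L. \<exists>x\<in>Y \<inter> L. W (r + 1) x z}" using finite_F that TL by auto
    then have "{z \<in> F L. \<exists>x\<in>Y \<inter> L. W (r + 1) x z} = {}"
      using wid that unfolding width_le_def by auto
    then show False using z that by blast
  qed
  show "{L \<in> T. x \<in> L} = {L \<in> T. y \<in> L}" if "x \<in> Y" "y \<in> Y" "W r x y" for x y
    using no_cross that near_sym by blast
  fix x assume xY: "x \<in> Y"
  obtain t where t: "t \<in> T" "x \<in> t" "\<And>L. L \<in> T \<Longrightarrow> x \<in> L \<Longrightarrow> t \<subseteq> L"
    "x \<in> nearF \<beta> t \<or> (\<exists>K. child K t \<and> K \<notin> T \<and> x \<in> K \<and> x \<in> nearF \<beta> K)"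
    by (rule coveredE[OF cov xY]) (rule that)
  define S where "S = {y \<in> Y. {L \<in> T. y \<in> L} = {L \<in> T. x \<in> L}}"
  have pt: "y \<in> nearF \<beta> t \<or> (\<exists>K. child K t \<and> y \<in> K \<and> y \<in> nearF \<beta> K)" if "y \<in> S" for y
  proof -
    have yY: "y \<in> Y" and eq: "\<And>L. L \<in> T \<Longrightarrow> y \<in> L \<longleftrightarrow> x \<in> L" using that unfolding S_def by blast+
    obtain t' where t': "t' \<in> T" "y \<in> t'" "\<And>L. L \<in> T \<Longrightarrow> y \<in> L \<Longrightarrow> t' \<subseteq> L"
      "y \<in> nearF \<beta> t' \<or> (\<exists>K. child K t' \<and> K \<notin> T \<and> y \<in> K \<and> y \<in> nearF \<beta> K)"
      by (rule coveredE[OF cov yY]) (rule that)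
    have "t' \<subseteq> t" using t t' eq by simp
    moreover have "t \<subseteq> t'" using t t' eq by simp
    ultimately have "t' = t" by (rule subset_antisym)
    then show ?thesis using t'(4) by auto
  qed
  let ?D2 = "nbd \<beta> r N"
  \<comment> \<open>The radius is at least \<open>r + 1\<close> so that every step that leaves a
    child of \<open>t\<close> starts in \<open>A\<close>.\<close>
  define A where "A = S \<inter> nearF (max \<beta> (r + 1)) t"
  have chB: "\<exists>K. child K t \<and> y \<in> K \<and> y \<in> nearF \<beta> K" if "y \<in> S - A" for y
  proof -
    have "y \<in> S" "y \<notin> nearF (max \<beta> (r + 1)) t" using that by (auto simp: A_def)
    moreover have "y \<notin> nearF \<beta> t" using nearF_mono[of y \<beta> t "max \<beta> (r + 1)"] calculation by auto
    ultimately show ?thesis using pt[of y] by blast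
  qed
  define g where "g y = (SOME K. child K t \<and> y \<in> K \<and> y \<in> nearF \<beta> K)" for y
  have g: "child (g y) t \<and> y \<in> g y \<and> y \<in> nearF \<beta> (g y)" if "y \<in> S - A" for y
    unfolding g_def using someI_ex[OF chB[OF that]] .
  have B: "cbd r ?D2 (S - A)"
  proof (rule cbd_split[where f = g])
    fix y z assume yz: "y \<in> S - A" "z \<in> S - A" "W r y z"
    have "z \<in> g y"
    proof (rule ccontr)
      assume "z \<notin> g y"
      then have "y \<in> nearF (r + 1) t" using separates_child[of "g y" t y z r] g[OF yz(1)] yz(3) by blast
      then have "y \<in> nearF (max \<beta> (r + 1)) t" by (rule nearF_mono) simp
      then show False using yz by (auto simp: A_def)
    qed
    then show "g y = g z" using child_disjoint[of "g y" t "g z" z] g[OF yz(1)] g[OF yz(2)] by blast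
  next
    fix y assume y: "y \<in> S - A"
    show "cbd r ?D2 {z \<in> S - A. g z = g y}"
    proof (rule cbd_nearF)
      show "g y \<in> \<L>" using g[OF y] by (simp add: child_def)
      show "{z \<in> S - A. g z = g y} \<subseteq> nearF \<beta> (g y)" using g by force
    qed
  qed
  have "cbd (?D2 + 2 * r) (nbd (max \<beta> (r + 1)) (?D2 + 2 * r) N) A"
    by (rule cbd_nearF[of t]) (use t TL in \<open>auto simp: A_def\<close>)
  from cbd_absorb_far[OF B this] have "cbd r (tree_bound N 0 r \<beta>) (A \<union> (S - A))" by simp
  moreover have "A \<union> (S - A) = S" by (auto simp: A_def)
  ultimately show "cbd r (tree_bound N 0 r \<beta>) {y \<in> Y. {L \<in> T. y \<in> L} = {L \<in> T. x \<in> L}}"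
    by (simp add: S_def)
qed

end

section \<open>One step of the induction on the width\<close>

locale tree_stage = tree_space +
  fixes L0 T Y r \<beta> n R' D'
  assumes inst: "instance_on L0 T Y" and wid: "width_le (Suc n) (R' + 6 * r + 4) T Y"
    and cov: "covered \<beta> T Y"
    and IH: "\<And>L T' Y'. instance_on L T' Y' \<Longrightarrow> width_le n R' T' Y' \<Longrightarrow> covered (max \<beta> (r + 1)) T' Y'
       \<Longrightarrow> \<exists>C. cbd (tree_jump N r) D' (Y' \<inter> C) \<and> cbd (tree_jump N r) D' (Y' - C)"
begin

text \<open>By \<open>separates\<close>, a step of length \<open>r\<close> that leaves
  \<open>M\<close> starts in the rim. So a step from \<open>deep M\<close> stays in
  \<open>M\<close>, but it may end on the rim.\<close>

definition rim :: "'a set \<Rightarrow> 'a set" where "rim M = Y \<inter> M \<inter> nearF (r + 1) M"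
definition deep :: "'a set \<Rightarrow> 'a set" where "deep M = Y \<inter> M - rim M"
text \<open>The radius is that of the block of the first colour around the hubs,
  \<open>2 * r + 1\<close>, plus one step. Sets outside \<open>top_part L\<close> thus contain no
  point of \<open>Y\<close> that is one step away from this block.\<close>

definition top_part :: "'a set \<Rightarrow> 'a set set" where
  "top_part L = {M \<in> T. M \<subseteq> L \<and> (M = L \<or> Y \<inter> M \<inter> nearF (3 * r + 1) L \<noteq> {})}"
definition far :: "'a set \<Rightarrow> 'a set set" where
  "far L = {M \<in> T. M \<subseteq> L \<and> M \<notin> top_part L \<and> (\<forall>J\<in>T. M \<subset> J \<longrightarrow> J \<subseteq> L \<longrightarrow> J \<in> top_part L)}"
definition stage :: "'a set \<Rightarrow> 'a set" where
  "stage L = Y \<inter> L - (\<Union>M\<in>far L. deep M)"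
definition rest :: "'a set \<Rightarrow> 'a set" where
  "rest L = stage L - nearF (R' + 6 * r + 4) L"

lemma TL: "T \<subseteq> \<L>" and L0T: "L0 \<in> T" and Y_sub: "Y \<subseteq> L0"
  using inst by (simp_all add: instance_on_def)

lemma T_sub: "L \<in> T \<Longrightarrow> L \<subseteq> L0"
  using inst unfolding instance_on_def by (elim conjE bspec)

lemma T_up: "L \<in> T \<Longrightarrow> M \<in> \<L> \<Longrightarrow> L \<subseteq> M \<Longrightarrow> M \<subseteq> L0 \<Longrightarrow> M \<in> T"
proof -
  assume a: "L \<in> T" "M \<in> \<L>" "L \<subseteq> M" "M \<subseteq> L0"
  have "\<forall>L\<in>T. \<forall>M\<in>\<L>. L \<subseteq> M \<longrightarrow> M \<subseteq> L0 \<longrightarrow> M \<in> T"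
    using inst unfolding instance_on_def by (elim conjE)
  from this[rule_format, OF a] show "M \<in> T" .
qed

lemma far_T: "M \<in> far L \<Longrightarrow> M \<in> T" and far_sub: "M \<in> far L \<Longrightarrow> M \<subseteq> L"
  by (auto simp: far_def)

lemma far_strict: "L \<in> T \<Longrightarrow> M \<in> far L \<Longrightarrow> M \<subset> L"
  by (auto simp: far_def top_part_def)

lemma far_disjoint:
  assumes "M \<in> far L" "M' \<in> far L" "M \<inter> M' \<noteq> {}"
  shows "M = M'"
proof -
  have "M \<in> \<L>" "M' \<in> \<L>" using assms far_T TL by auto
  then have "M \<subseteq> M' \<or> M' \<subseteq> M" using laminar assms by blast
  then show ?thesis using assms by (auto simp: far_def)
qed

lemma far_away: "M \<in> far L \<Longrightarrow> x \<in> Y \<Longrightarrow> x \<in> M \<Longrightarrow> x \<notin> nearF (3 * r + 1) L"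
  by (auto simp: far_def top_part_def)

lemma far_exit:
  assumes M: "M \<in> far L" and x: "x \<in> deep M" and y: "y \<in> Y" "y \<notin> deep M" and xy: "W r x y"
  shows "x \<in> nearF (2 * r + 1) M"
proof -
  have M_L: "M \<in> \<L>" using M far_T TL by blast
  have xM: "x \<in> M" "x \<notin> nearF (r + 1) M" using x by (auto simp: deep_def rim_def)
  have "y \<in> M" using separates_nearF[OF M_L xM(1) _ xy] xM by blast
  then have "y \<in> nearF (r + 1) M" using y by (auto simp: deep_def rim_def)
  then show ?thesis by (rule nearF_step[OF _ near_sym[OF xy]]) simp
qed

lemma top_part_up:
  assumes "M \<in> top_part L" "K \<in> T" "M \<subseteq> K" "K \<subseteq> L"
  shows "K \<in> top_part L"
  using assms by (auto simp: top_part_def)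

lemma rest_instance: "L \<in> T \<Longrightarrow> instance_on L (top_part L) (rest L)"
  unfolding instance_on_def
proof (intro conjI ballI impI)
  fix M K assume L: "L \<in> T" and M: "M \<in> top_part L" and K: "K \<in> \<L>" "M \<subseteq> K" "K \<subseteq> L"
  have "K \<in> T" using T_up[of M K] M K T_sub[OF L] by (auto simp: top_part_def)
  then show "K \<in> top_part L" using top_part_up M K by blast
qed (use TL in \<open>auto simp: top_part_def rest_def stage_def\<close>)

text \<open>A set \<open>M\<close> in \<open>top_part L\<close> other than \<open>L\<close> has a
  point \<open>x\<close> near a hub \<open>w\<close> of \<open>L\<close>, and \<open>w\<close> is
  outside \<open>M\<close> by \<open>F_core\<close>. Hence a hub \<open>z0\<close> of
  \<open>M\<close> is near \<open>x\<close>. It counted for \<open>Y\<close>, but it is too close to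
  \<open>w\<close> to count for \<open>rest L\<close>, which avoids the surroundings of the hubs of
  \<open>L\<close>.\<close>

lemma rest_width:
  assumes L: "L \<in> T"
  shows "width_le n R' (top_part L) (rest L)"
  unfolding width_le_def
proof
  fix M assume M: "M \<in> top_part L"
  let ?new = "{z \<in> F M. \<exists>x\<in>rest L \<inter> M. W (R' + 1) x z}"
  have LL: "L \<in> \<L>" and M_L: "M \<in> \<L>" and MT: "M \<in> T" using L M TL by (auto simp: top_part_def)
  have away: "x \<notin> nearF (R' + 6 * r + 4) L" if "x \<in> rest L" for x
    using that by (simp add: rest_def)
  show "card ?new \<le> n"
  proof (cases "M = L")
    case True
    have "?new = {}"
    proof (rule ccontr)
      assume "?new \<noteq> {}"
      then obtain z x where z: "z \<in> F L" "x \<in> rest L" "W (R' + 1) x z" using True by auto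
      have "x \<in> nearF (R' + 1) L" using z by (auto simp: nearF_def)
      then have "x \<in> nearF (R' + 6 * r + 4) L" by (rule nearF_mono) simp
      then show False using away z by blast
    qed
    then show ?thesis by (simp only: card.empty le0)
  next
    case False
    then obtain x w where x: "x \<in> Y" "x \<in> M" "w \<in> F L" "W (3 * r + 1) x w" and sub: "M \<subset> L"
      using M by (auto simp: top_part_def nearF_def)
    have "w \<notin> M" using F_core[OF LL M_L sub] x by blast
    then obtain z0 where z0: "z0 \<in> F M" "W (3 * r + 2) x z0"
      using separates[OF M_L x(2) _ x(4)] by auto
    let ?old = "{z \<in> F M. \<exists>x\<in>Y \<inter> M. W (R' + 6 * r + 4 + 1) x z}"
    have fin: "finite ?old" using finite_F[OF M_L] by simp
    have "card ?old \<le> Suc n" using wid MT by (simp add: width_le_def)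
    moreover have "?new \<subseteq> ?old - {z0}"
    proof
      fix z assume "z \<in> ?new"
      then obtain x' where x': "z \<in> F M" "x' \<in> rest L" "x' \<in> M" "W (R' + 1) x' z" by auto
      have "z \<noteq> z0"
      proof
        assume "z = z0"
        then have "W ((R' + 1) + (3 * r + 2)) x' x"
          using x' near_trans near_sym[OF z0(2)] by blast
        then have "W (((R' + 1) + (3 * r + 2)) + (3 * r + 1)) x' w" using x near_trans by blast
        then have "W (R' + 6 * r + 4) x' w" by (rule near_mono) simp
        then have "x' \<in> nearF (R' + 6 * r + 4) L" using x(3) by (auto simp: nearF_def)
        then show False using away x' by blast
      qed
      moreover have "x' \<in> Y" using x' by (simp add: rest_def stage_def)
      moreover have "W (R' + 6 * r + 4 + 1) x' z" using x'(4) by (rule near_mono) simp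
      ultimately show "z \<in> ?old - {z0}" using x' by blast
    qed
    moreover have "z0 \<in> ?old"
    proof -
      have "W (R' + 6 * r + 4 + 1) x z0" using z0(2) by (rule near_mono) simp
      then show ?thesis using z0 x by blast
    qed
    ultimately show ?thesis
      using fin card_mono[of "?old - {z0}" ?new] card_Diff_singleton[of z0 ?old] by simp
  qed
qed

text \<open>If the smallest set around \<open>x\<close> was pruned, the largest pruned set
  \<open>M\<close> around \<open>x\<close> belongs to \<open>far L\<close>. As \<open>x\<close>
  survived, it is on the rim of \<open>M\<close>, hence near its hubs, and the set \<open>K\<close>
  right above \<open>M\<close> is the smallest one left.\<close>

lemma rest_covered:
  assumes L: "L \<in> T"
  shows "covered (max \<beta> (r + 1)) (top_part L) (rest L)"
  unfolding covered_def
proof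
  fix x assume x: "x \<in> rest L"
  then have xY: "x \<in> Y" and xL: "x \<in> L" by (auto simp: rest_def stage_def)
  obtain t where t: "t \<in> T" "x \<in> t" "\<And>L. L \<in> T \<Longrightarrow> x \<in> L \<Longrightarrow> t \<subseteq> L"
    "x \<in> nearF \<beta> t \<or> (\<exists>K. child K t \<and> K \<notin> T \<and> x \<in> K \<and> x \<in> nearF \<beta> K)"
    by (rule coveredE[OF cov xY]) (rule that)
  have tL: "t \<subseteq> L" using t L xL by blast
  have sub: "top_part L \<subseteq> T" by (auto simp: top_part_def)
  have mono: "y \<in> nearF \<beta> K \<Longrightarrow> y \<in> nearF (max \<beta> (r + 1)) K" for y K
    by (erule nearF_mono) simp
  show "\<exists>t\<in>top_part L. x \<in> t \<and> (\<forall>L'\<in>top_part L. x \<in> L' \<longrightarrow> t \<subseteq> L') \<and>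
     (x \<in> nearF (max \<beta> (r + 1)) t \<or>
      (\<exists>K. child K t \<and> K \<notin> top_part L \<and> x \<in> K \<and> x \<in> nearF (max \<beta> (r + 1)) K))"
  proof (cases "t \<in> top_part L")
    case True
    then show ?thesis using t sub mono by (intro bexI[of _ t]) auto
  next
    case False
    have finT: "finite T" using finite_subset[OF TL finite_L] .
    obtain M where M: "M \<in> {J \<in> T. t \<subseteq> J \<and> J \<subseteq> L \<and> J \<notin> top_part L}"
      "\<forall>J\<in>{J \<in> T. t \<subseteq> J \<and> J \<subseteq> L \<and> J \<notin> top_part L}. M \<subseteq> J \<longrightarrow> M = J"
      using finite_has_maximal[of "{J \<in> T. t \<subseteq> J \<and> J \<subseteq> L \<and> J \<notin> top_part L}"] finT t tL False by auto
    have Mfar: "M \<in> far L" unfolding far_def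
    proof (intro CollectI conjI ballI impI)
      fix J assume J: "J \<in> T" "M \<subset> J" "J \<subseteq> L"
      show "J \<in> top_part L"
      proof (rule ccontr)
        assume "J \<notin> top_part L"
        moreover have "t \<subseteq> J" using M(1) J(2) by auto
        ultimately have "J \<in> {J \<in> T. t \<subseteq> J \<and> J \<subseteq> L \<and> J \<notin> top_part L}" using J by auto
        then have "M = J" using M(2) J(2) by auto
        then show False using J(2) by auto
      qed
    qed (use M(1) in auto)
    have M_L: "M \<in> \<L>" "M \<in> T" "x \<in> M" using M t TL by auto
    have "M \<subset> L" using far_strict[OF L Mfar] .
    then have "L \<in> {J \<in> T. M \<subset> J \<and> J \<subseteq> L}" using L by simp
    then have ne: "{J \<in> T. M \<subset> J \<and> J \<subseteq> L} \<noteq> {}" by (metis empty_iff)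
    have "finite {J \<in> T. M \<subset> J \<and> J \<subseteq> L}" using finT by simp
    from finite_has_minimal[OF this ne] obtain K where K: "K \<in> {J \<in> T. M \<subset> J \<and> J \<subseteq> L}"
      "\<forall>J\<in>{J \<in> T. M \<subset> J \<and> J \<subseteq> L}. J \<subseteq> K \<longrightarrow> K = J"
      by (rule bexE) (rule that)
    then have Ktop: "K \<in> top_part L" using Mfar by (auto simp: far_def)
    have KL: "K \<in> \<L>" "K \<in> T" using K TL by auto
    have min: "K \<subseteq> J" if J: "J \<in> top_part L" "x \<in> J" for J
    proof -
      have JT: "J \<in> T" "J \<in> \<L>" "J \<subseteq> L" using J sub TL by (auto simp: top_part_def)
      have "\<not> J \<subseteq> M" using top_part_up[OF J(1) M_L(2)] Mfar by (auto simp: far_def)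
      then have "M \<subset> J" using laminar[OF M_L(1) JT(2)] M_L J by blast
      then have "J \<subseteq> K \<Longrightarrow> K = J" using K JT by blast
      moreover have "J \<subseteq> K \<or> K \<subseteq> J" using laminar[OF KL(1) JT(2)] K J M_L by blast
      ultimately show ?thesis by blast
    qed
    have "child M K" unfolding child_def
    proof (intro conjI ballI impI)
      fix J assume J: "J \<in> \<L>" "M \<subset> J"
      show "\<not> J \<subset> K"
      proof
        assume "J \<subset> K"
        then have "J \<subseteq> L" using K by auto
        moreover have "J \<subseteq> L0" using calculation T_sub[OF L] by auto
        moreover have "J \<in> T" using T_up[OF M_L(2) J(1)] calculation J by auto
        ultimately show False using K J \<open>J \<subset> K\<close> by blast
      qed
    qed (use KL M_L K in auto)
    moreover have "x \<in> nearF (max \<beta> (r + 1)) M"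
    proof -
      have "x \<notin> deep M" using x Mfar by (auto simp: rest_def stage_def)
      then have "x \<in> nearF (r + 1) M" using M_L xY by (auto simp: deep_def rim_def)
      then show ?thesis by (rule nearF_mono) simp
    qed
    moreover have "M \<notin> top_part L" using Mfar by (simp add: far_def)
    moreover have "x \<in> K" using K M_L by auto
    ultimately show ?thesis using Ktop min M_L by (intro bexI[of _ K]) auto
  qed
qed

end

context tree_stage begin

text \<open>\<open>C\<close> is the first colour, its complement the second. The first two clauses
  make the points near the hubs of \<open>L\<close> a block of the first colour with no
  \<open>r\<close>-steps to the rest of that colour in \<open>Z\<close>.\<close>

definition good_colouring :: "nat \<Rightarrow> 'a set \<Rightarrow> 'a set \<Rightarrow> 'a set \<Rightarrow> bool" where
  "good_colouring D L Z C \<longleftrightarrow> Z \<inter> nearF (2 * r + 1) L \<subseteq> C \<and>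
     (\<forall>x\<in>Z \<inter> C. \<forall>y\<in>Z \<inter> C. W r x y \<longrightarrow> x \<in> nearF (2 * r + 1) L \<longrightarrow> y \<in> nearF (2 * r + 1) L) \<and>
     cbd r D (Z \<inter> C) \<and> cbd r D (Z - C)"

lemma good_colouringD:
  assumes "good_colouring D L Z C"
  shows "x \<in> Z \<Longrightarrow> x \<in> nearF (2 * r + 1) L \<Longrightarrow> x \<in> C"
    and "x \<in> Z \<Longrightarrow> x \<in> C \<Longrightarrow> y \<in> Z \<Longrightarrow> y \<in> C \<Longrightarrow> W r x y \<Longrightarrow> x \<in> nearF (2 * r + 1) L \<Longrightarrow> y \<in> nearF (2 * r + 1) L"
    and "cbd r D (Z \<inter> C)" and "cbd r D (Z - C)"
  using assms unfolding good_colouring_def by blast+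

text \<open>The points of \<open>L\<close> closest to its hubs get the first colour, a thick layer around them the second
  one, and the rest is coloured by induction on the width. The sets in \<open>far L\<close> start over inside
  their rims. By the choice of \<open>tree_jump\<close> their first layers do not join different components of
  the rest, and their thick layers stop what comes from above.\<close>

lemma stage_colouring:
  assumes L: "L \<in> T"
    and col: "\<And>M. M \<in> far L \<Longrightarrow> \<exists>C. good_colouring D M (deep M) C"
    and Z: "Y \<inter> L - rim L \<subseteq> Z" "Z \<subseteq> Y \<inter> L"
    and D: "D = nbd (2 * r + 1) r N + (D' + 2 * (nbd (2 * r + 1) r N + r)) +
       (nbd (R' + 6 * r + 4) (D' + 2 * r) N + 2 * (D' + r))"
  shows "\<exists>C. good_colouring D L Z C"
proof -
  let ?q = "nbd (2 * r + 1) r N"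
  let ?near = "nearF (2 * r + 1)"
  have LL: "L \<in> \<L>" using L TL by blast
  obtain CM where CM: "\<And>M. M \<in> far L \<Longrightarrow> good_colouring D M (deep M) (CM M)"
    using col by metis
  obtain C0 where C0: "cbd (tree_jump N r) D' (rest L \<inter> C0)" "cbd (tree_jump N r) D' (rest L - C0)"
    using IH[OF rest_instance[OF L] rest_width[OF L] rest_covered[OF L]] by blast
  have jump: "r \<le> tree_jump N r" by (simp add: tree_jump_def)
  define C where "C = {x. (\<exists>M\<in>far L. x \<in> deep M \<and> x \<in> CM M) \<or>
    (x \<in> stage L \<and> (x \<in> ?near L \<or> x \<in> rest L \<inter> C0))}"
  have deep_Y: "x \<in> Y" "x \<in> M" if "x \<in> deep M" for x M using that by (auto simp: deep_def)
  have uniq: "M = M'" if "M \<in> far L" "M' \<in> far L" "x \<in> deep M" "x \<in> deep M'" for x M M'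
    using far_disjoint[OF that(1,2)] deep_Y(2)[OF that(3)] deep_Y(2)[OF that(4)] by blast
  have C_deep: "x \<in> C \<longleftrightarrow> x \<in> CM M" if "M \<in> far L" "x \<in> deep M" for x M
  proof
    have "x \<notin> stage L" using that unfolding stage_def by blast
    moreover assume "x \<in> C"
    ultimately obtain M' where M': "M' \<in> far L" "x \<in> deep M'" "x \<in> CM M'"
      unfolding C_def by blast
    show "x \<in> CM M" using uniq[OF M'(1) that(1) M'(2) that(2)] M'(3) by (rule subst)
  next
    assume "x \<in> CM M"
    then show "x \<in> C" using that unfolding C_def by blast
  qed
  have stage_in: "x \<in> stage L" if "x \<in> Z" "\<And>M. M \<in> far L \<Longrightarrow> x \<notin> deep M" for x
    using that Z(2) unfolding stage_def by blast
  have C_stage: "x \<in> C \<longleftrightarrow> x \<in> ?near L \<or> x \<in> rest L \<inter> C0"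
    if "x \<in> Z" "\<And>M. M \<in> far L \<Longrightarrow> x \<notin> deep M" for x
    using stage_in[OF that] that(2) by (auto simp: C_def)
  have near_not_deep: "x \<notin> deep M" if "x \<in> nearF (3 * r + 1) L" "M \<in> far L" for x M
    using far_away[OF that(2)] deep_Y[of x M] that(1) by blast
  have near_not_rest: "x \<notin> rest L" if "x \<in> nearF (3 * r + 1) L" for x
    using nearF_mono[OF that, of "R' + 6 * r + 4"] by (simp add: rest_def)
  have ZY: "x \<in> Y" if "x \<in> Z" for x using that Z by blast
  \<comment> \<open>An exit from \<open>deep M\<close> is near the hubs of \<open>M\<close> and so
    has the first colour. Components of the second colour therefore never cross the boundary of a
    far set.\<close>
  have leave: "x \<in> C \<and> x \<in> ?near M" if "M \<in> far L" "x \<in> deep M" "y \<in> Y" "y \<notin> deep M" "W r x y" for x y M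
  proof -
    have "x \<in> ?near M" using far_exit[OF that] .
    then show ?thesis using good_colouringD(1)[OF CM[OF that(1)] that(2)] C_deep[OF that(1,2)] by blast
  qed
  have i: "x \<in> C" if "x \<in> Z" "x \<in> ?near L" for x
  proof -
    have "x \<in> nearF (3 * r + 1) L" using that(2) by (rule nearF_mono) simp
    then show ?thesis using C_stage[OF that(1)] near_not_deep that(2) by blast
  qed
  have ii: "y \<in> ?near L" if "x \<in> Z" "y \<in> Z" "y \<in> C" "W r x y" "x \<in> ?near L" for x y
  proof -
    have y: "y \<in> nearF (3 * r + 1) L" using that(5,4) by (rule nearF_step) simp
    then show ?thesis using C_stage[OF that(2)] near_not_deep[OF y] near_not_rest[OF y] that(3) by blast
  qed
  have one: "cbd r D (Z - C)"
  proof (rule cbd_split[where f = "\<lambda>x. {M \<in> far L. x \<in> deep M}"])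
    have "y \<in> deep M" if "x \<in> Z - C" "y \<in> Z - C" "W r x y" "M \<in> far L" "x \<in> deep M" for x y M
      using leave[OF that(4,5) _ _ that(3)] that ZY by blast
    then show "{M \<in> far L. x \<in> deep M} = {M \<in> far L. y \<in> deep M}"
      if "x \<in> Z - C" "y \<in> Z - C" "W r x y" for x y
      using that near_sym[OF that(3)] by blast
  next
    fix x assume x: "x \<in> Z - C"
    let ?S = "{y \<in> Z - C. {M \<in> far L. y \<in> deep M} = {M \<in> far L. x \<in> deep M}}"
    show "cbd r D ?S"
    proof (cases "\<exists>M\<in>far L. x \<in> deep M")
      case True
      then obtain M where M: "M \<in> far L" "x \<in> deep M" by blast
      have "?S \<subseteq> deep M - CM M"
      proof
        fix y assume y: "y \<in> ?S"
        then have "y \<in> deep M" using M by blast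
        then show "y \<in> deep M - CM M" using y C_deep[OF M(1)] by blast
      qed
      then show ?thesis by (rule cbd_mono[OF good_colouringD(4)[OF CM[OF M(1)]]]) auto
    next
      case False
      \<comment> \<open>The thick layer around the hubs has bounded components at every scale, in
        particular at the one that jumps over the components of \<open>rest L - C0\<close>.\<close>
      let ?A = "stage L \<inter> nearF (R' + 6 * r + 4) L"
      have "cbd r D' (rest L - C0)" by (rule cbd_mono[OF C0(2) _ jump]) auto
      moreover have "cbd (D' + 2 * r) (nbd (R' + 6 * r + 4) (D' + 2 * r) N) ?A"
        by (rule cbd_nearF[OF LL]) auto
      ultimately have c: "cbd r (nbd (R' + 6 * r + 4) (D' + 2 * r) N + 2 * (D' + r)) (?A \<union> (rest L - C0))"
        by (rule cbd_absorb_far) simp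
      have "?S \<subseteq> ?A \<union> (rest L - C0)"
      proof
        fix y assume y: "y \<in> ?S"
        then have nd: "y \<notin> deep M" if "M \<in> far L" for M using False that by blast
        have yZ: "y \<in> Z" and "y \<notin> C" using y by auto
        then have "y \<notin> rest L \<inter> C0" using C_stage[OF yZ nd] by blast
        moreover have "y \<in> stage L" using stage_in[OF yZ nd] .
        ultimately show "y \<in> ?A \<union> (rest L - C0)" by (auto simp: rest_def)
      qed
      then show ?thesis by (rule cbd_mono[OF c]) (simp_all add: D)
    qed
  qed
  \<comment> \<open>The blocks of the first colour: near the hubs of \<open>L\<close>, inside one
    far set but away from its hubs, and the remaining points. The Boolean tells the first kind from
    the last, as both carry the empty set.\<close>
  define g where "g x = (if x \<in> ?near L then (True, {})
    else (False, {M \<in> far L. x \<in> deep M \<and> x \<notin> ?near M}))" for x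
  have zero: "cbd r D (Z \<inter> C)"
  proof (rule cbd_split[where f = g])
    have step: "y \<in> deep M \<and> y \<notin> ?near M"
      if "x \<in> Z \<inter> C" "y \<in> Z \<inter> C" "W r x y" "M \<in> far L" "x \<in> deep M" "x \<notin> ?near M" for x y M
    proof -
      have y: "y \<in> deep M" using leave[OF that(4,5) _ _ that(3)] that ZY by blast
      have "x \<in> CM M" "y \<in> CM M" using C_deep[OF that(4)] that y by blast+
      then show ?thesis
        using good_colouringD(2)[OF CM[OF that(4)] y _ that(5) _ near_sym[OF that(3)]] y that(6) by blast
    qed
    fix x y assume xy: "x \<in> Z \<inter> C" "y \<in> Z \<inter> C" "W r x y"
    have "x \<in> ?near L \<longleftrightarrow> y \<in> ?near L" using ii xy near_sym[OF xy(3)] by blast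
    moreover have "{M \<in> far L. x \<in> deep M \<and> x \<notin> ?near M} = {M \<in> far L. y \<in> deep M \<and> y \<notin> ?near M}"
      using step[OF xy] step[OF xy(2,1) near_sym[OF xy(3)]] by blast
    ultimately show "g x = g y" by (simp add: g_def)
  next
    fix x assume x: "x \<in> Z \<inter> C"
    let ?S = "{y \<in> Z \<inter> C. g y = g x}"
    consider "x \<in> ?near L" | M where "x \<notin> ?near L" "M \<in> far L" "x \<in> deep M" "x \<notin> ?near M"
      | "x \<notin> ?near L" "\<And>M. M \<in> far L \<Longrightarrow> x \<in> deep M \<Longrightarrow> x \<in> ?near M" by blast
    then show "cbd r D ?S"
    proof cases
      case 1
      have "cbd r ?q (?near L)" by (rule cbd_nearF[OF LL]) auto
      moreover have "?S \<subseteq> ?near L" using 1 by (auto simp: g_def split: if_splits)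
      ultimately show ?thesis by (rule cbd_mono) (simp_all add: D)
    next
      case 2
      have "?S \<subseteq> deep M \<inter> CM M"
      proof
        fix y assume y: "y \<in> ?S"
        have "M \<in> snd (g x)" using 2 by (simp add: g_def)
        then have "M \<in> snd (g y)" using y by simp
        then have "y \<in> deep M" by (auto simp: g_def split: if_splits)
        then show "y \<in> deep M \<inter> CM M" using y C_deep[OF 2(2)] by blast
      qed
      then show ?thesis by (rule cbd_mono[OF good_colouringD(3)[OF CM[OF 2(2)]]]) auto
    next
      case 3
      \<comment> \<open>These blocks around the hubs of the far sets are the only parts of the
        inserted colourings that touch \<open>rest L\<close>. Steps of length
        \<open>tree_jump N r\<close>, the scale at which \<open>C0\<close> was chosen, jump over
        their components.\<close>
      let ?B = "\<Union>M\<in>far L. deep M \<inter> ?near M"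
      have B: "cbd r ?q ?B"
      proof (rule cbd_split[where f = "\<lambda>x. {M \<in> far L. x \<in> deep M}"])
        have st: "v \<in> deep M" if a: "u \<in> deep M" "M \<in> far L" "v \<in> ?B" "W r u v" for u v M
        proof -
          obtain M' where M': "M' \<in> far L" "v \<in> deep M'" using a(3) by blast
          have "v \<in> M"
          proof (rule ccontr)
            assume "v \<notin> M"
            then have "u \<in> nearF (r + 1) M"
              using separates_nearF[of M u v r] far_T TL deep_Y(2)[OF that(1)] that(2,4) by blast
            then show False using that(1) by (auto simp: deep_def rim_def)
          qed
          then have "M = M'" using far_disjoint[OF that(2) M'(1)] deep_Y(2)[OF M'(2)] by blast
          then show ?thesis using M' by simp
        qed
        show "{M \<in> far L. u \<in> deep M} = {M \<in> far L. v \<in> deep M}"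
          if "u \<in> ?B" "v \<in> ?B" "W r u v" for u v
          using st[of u _ v] st[of v _ u] that near_sym[OF that(3)] by blast
        fix u assume "u \<in> ?B"
        then obtain M where M: "M \<in> far L" "u \<in> deep M" by blast
        show "cbd r ?q {v \<in> ?B. {M \<in> far L. v \<in> deep M} = {M \<in> far L. u \<in> deep M}}"
        proof (rule cbd_nearF)
          show "M \<in> \<L>" using M far_T TL by blast
          show "{v \<in> ?B. {M \<in> far L. v \<in> deep M} = {M \<in> far L. u \<in> deep M}} \<subseteq> ?near M"
          proof
            fix v assume v: "v \<in> {v \<in> ?B. {M \<in> far L. v \<in> deep M} = {M \<in> far L. u \<in> deep M}}"
            then have "v \<in> deep M" using M by blast
            moreover obtain M' where "M' \<in> far L" "v \<in> deep M'" "v \<in> ?near M'" using v by blast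
            ultimately show "v \<in> ?near M" using uniq[OF M(1)] by metis
          qed
        qed
      qed
      have "cbd r (D' + 2 * (?q + r)) ((rest L \<inter> C0) \<union> ?B)"
        by (rule cbd_absorb_far[OF B C0(1)]) (simp add: tree_jump_def)
      moreover have "?S \<subseteq> (rest L \<inter> C0) \<union> ?B"
      proof
        fix y assume y: "y \<in> ?S"
        then have yZ: "y \<in> Z" "y \<in> C" by auto
        have gx: "g x = (False, {})" using 3 by (auto simp: g_def)
        then have gy: "g y = (False, {})" using y by simp
        then have near: "y \<notin> ?near L" by (auto simp: g_def split: if_splits)
        show "y \<in> (rest L \<inter> C0) \<union> ?B"
        proof (cases "\<exists>M\<in>far L. y \<in> deep M")
          case True
          then show ?thesis using gy near by (auto simp: g_def)
        next
          case False
          then show ?thesis using C_stage[OF yZ(1)] yZ near by blast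
        qed
      qed
      ultimately show ?thesis by (rule cbd_mono) (simp_all add: D)
    qed
  qed
  have "good_colouring D L Z C"
    unfolding good_colouring_def using i ii one zero by blast
  then show ?thesis ..
qed

lemma stage_total:
  assumes D: "D = nbd (2 * r + 1) r N + (D' + 2 * (nbd (2 * r + 1) r N + r)) +
       (nbd (R' + 6 * r + 4) (D' + 2 * r) N + 2 * (D' + r))"
  shows "\<exists>C. cbd r D (Y \<inter> C) \<and> cbd r D (Y - C)"
proof -
  \<comment> \<open>\<open>Z\<close> is left free because a far set is coloured without its rim,
    while the root \<open>L0\<close> needs all of \<open>Y\<close>. The bound \<open>D\<close> is
    the same for every \<open>L\<close>.\<close>
  have "\<exists>C. good_colouring D L Z C"
    if "L \<in> T" "Y \<inter> L - rim L \<subseteq> Z" "Z \<subseteq> Y \<inter> L" for L Z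
    using that
  proof (induction "card {M \<in> T. M \<subseteq> L}" arbitrary: L Z rule: less_induct)
    case less
    show ?case
    proof (rule stage_colouring[OF less.prems(1) _ less.prems(2,3) D])
      fix M assume M: "M \<in> far L"
      have MT: "M \<in> T" "M \<subset> L" using far_T[OF M] far_strict[OF less.prems(1) M] by auto
      have fin: "finite {J \<in> T. J \<subseteq> L}" using finite_subset[OF TL finite_L] by simp
      have "{J \<in> T. J \<subseteq> M} \<subset> {J \<in> T. J \<subseteq> L}" using MT less.prems(1) by blast
      then have "card {J \<in> T. J \<subseteq> M} < card {J \<in> T. J \<subseteq> L}" by (rule psubset_card_mono[OF fin])
      then show "\<exists>C. good_colouring D M (deep M) C"
        by (rule less.hyps[OF _ MT(1)]) (auto simp: deep_def)
    qed
  qed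
  from this[OF L0T, of Y] Y_sub obtain C where "good_colouring D L0 Y C" by blast
  then show ?thesis using good_colouringD by blast
qed

end

context tree_space begin

theorem tree_two_colouring:
  assumes "instance_on L0 T Y" "width_le n (tree_range N n r \<beta>) T Y" "covered \<beta> T Y"
  shows "\<exists>C. cbd r (tree_bound N n r \<beta>) (Y \<inter> C) \<and> cbd r (tree_bound N n r \<beta>) (Y - C)"
  using assms
proof (induction n arbitrary: r \<beta> L0 T Y)
  case 0
  then have "cbd r (tree_bound N 0 r \<beta>) Y" using tree_base by simp
  moreover have "cbd r (tree_bound N 0 r \<beta>) {}" using conn_in by (auto simp: cbd_def)
  ultimately show ?case by (intro exI[of _ UNIV]) (simp del: tree_bound.simps)
next
  case (Suc n)
  interpret tree_stage W \<L> F N L0 T Y r \<beta> n "tree_range N n (tree_jump N r) (max \<beta> (r + 1))"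
    "tree_bound N n (tree_jump N r) (max \<beta> (r + 1))"
    by unfold_locales (use Suc in simp_all)
  show ?case by (rule stage_total) (simp add: Let_def)
qed

end

section \<open>Graphs with hubs\<close>

fun reach :: "('a \<times> 'a) set \<Rightarrow> nat \<Rightarrow> 'a \<Rightarrow> 'a \<Rightarrow> bool" where
  "reach E 0 x y \<longleftrightarrow> x = y"
| "reach E (Suc k) x y \<longleftrightarrow> (\<exists>z. reach E k x z \<and> (z = y \<or> (z, y) \<in> E))"

lemma reach_trans: "reach E j x y \<Longrightarrow> reach E k y z \<Longrightarrow> reach E (j + k) x z"
  by (induction k arbitrary: z) auto

lemma reach_edge: "(x, y) \<in> E \<Longrightarrow> reach E (Suc 0) x y"
  by simp

lemma reach_mono: "reach E j x y \<Longrightarrow> j \<le> k \<Longrightarrow> reach E k x y"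
  by (induction k) (auto simp: le_Suc_eq)

lemma reach_sym: "sym E \<Longrightarrow> reach E k x y \<Longrightarrow> reach E k y x"
proof (induction k arbitrary: y)
  case (Suc k)
  then obtain z where z: "reach E k z x" "z = y \<or> (y, z) \<in> E" by (auto dest: symD)
  then have "reach E (Suc 0) y z" by auto
  from reach_trans[OF this z(1)] show ?case by simp
qed auto

lemma near_space_reach: "sym E \<Longrightarrow> near_space (reach E)"
  by unfold_locales (auto intro: reach_trans reach_mono reach_sym)

lemma reach_exit:
  assumes "reach E k x y" "x \<in> P" "y \<notin> P"
  obtains u v i where "(u, v) \<in> E" "u \<in> P" "v \<notin> P" "i < k" "reach E i x u" "reach E (k - Suc i) v y"
  using assms
proof (induction k arbitrary: y thesis)
  case (Suc k)
  from Suc.prems(2) obtain z where z: "reach E k x z" "z = y \<or> (z, y) \<in> E" by auto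
  show ?case
  proof (cases "z \<in> P")
    case True
    then show ?thesis using Suc.prems(4) z Suc.prems(1)[of z y k] by auto
  next
    case False
    obtain u v i where *: "(u, v) \<in> E" "u \<in> P" "v \<notin> P" "i < k" "reach E i x u" "reach E (k - Suc i) v z"
      using Suc.IH[OF _ z(1) Suc.prems(3) False] by blast
    have "reach E (Suc (k - Suc i)) v y" using *(6) z(2) by auto
    moreover have "Suc (k - Suc i) = Suc k - Suc i" using *(4) by simp
    ultimately show ?thesis using Suc.prems(1)[of u v i] * by simp
  qed
qed simp

text \<open>The interface to the geometry: \<tau> \<open>x\<close> will be the part of the space in
  the cell of \<open>x\<close>. Hubs are demanded only near points that own the cell, i.e. have it
  as their own cell, or from which one step leaves it.\<close>

locale hub_space = near_space W
  for W :: "nat \<Rightarrow> 'v \<Rightarrow> 'v \<Rightarrow> bool" +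
  fixes X :: "'v set" and \<tau> :: "'v \<Rightarrow> 'v set" and Z :: "'v set \<Rightarrow> 'v set" and r \<rho> N :: nat
  assumes finite_X: "finite X" and X_ne: "X \<noteq> {}"
    and tau_self: "x \<in> X \<Longrightarrow> x \<in> \<tau> x"
    and tau_sub: "x \<in> X \<Longrightarrow> \<tau> x \<subseteq> X"
    and tau_trans: "x \<in> X \<Longrightarrow> y \<in> \<tau> x \<Longrightarrow> \<tau> y \<subseteq> \<tau> x"
    and tau_laminar: "x \<in> X \<Longrightarrow> y \<in> X \<Longrightarrow> \<tau> x \<subseteq> \<tau> y \<or> \<tau> y \<subseteq> \<tau> x \<or> \<tau> x \<inter> \<tau> y = {}"
    and tau_comparable: "x \<in> X \<Longrightarrow> y \<in> X \<Longrightarrow> W r x y \<Longrightarrow> x \<in> \<tau> y \<or> y \<in> \<tau> x"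
    and finite_Z: "a \<in> X \<Longrightarrow> finite (Z (\<tau> a))"
    and card_Z: "a \<in> X \<Longrightarrow> card (Z (\<tau> a)) \<le> N"
    and Z_near: "a \<in> X \<Longrightarrow> x \<in> \<tau> a \<Longrightarrow> \<tau> x = \<tau> a \<or> (\<exists>y\<in>X - \<tau> a. W r x y) \<Longrightarrow>
        \<exists>z\<in>Z (\<tau> a). W \<rho> x z"
begin

text \<open>\<open>X\<close> is added as the root of the forest. Unless it is the cell of some
  point, its border is empty and it gets no hubs.\<close>

definition LL :: "'v set set" where "LL = insert X (\<tau> ` X)"
definition hubs :: "'v set \<Rightarrow> 'v set" where "hubs L = (if L \<in> \<tau> ` X then Z L else {})"
definition border :: "'v set \<Rightarrow> 'v set" where
  "border L = {x \<in> L. \<tau> x = L \<or> (\<exists>y\<in>X - L. W r x y)}"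
text \<open>Each set gets private copies of its hubs. A hub of \<open>L\<close> may itself lie in a
  smaller set or outside \<open>X\<close>; its copy lies in no smaller set, as \<open>F_core\<close>
  demands.\<close>

definition edges :: "('v + 'v set \<times> 'v) rel" where
  "edges = {(Inl x, Inl y) |x y. x \<in> X \<and> y \<in> X \<and> W r x y} \<union>
     {(Inl x, Inr (L, z)) |x L z. L \<in> LL \<and> x \<in> border L \<and> z \<in> hubs L \<and> W \<rho> x z} \<union>
     {(Inr (L, z), Inl x) |x L z. L \<in> LL \<and> x \<in> border L \<and> z \<in> hubs L \<and> W \<rho> x z}"
definition hat :: "'v set \<Rightarrow> ('v + 'v set \<times> 'v) set" where
  "hat L = Inl ` L \<union> {Inr (M, z) |M z. M \<in> LL \<and> M \<subseteq> L}"
definition FF :: "('v + 'v set \<times> 'v) set \<Rightarrow> ('v + 'v set \<times> 'v) set" where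
  "FF P = (\<lambda>z. Inr (Inl -` P, z)) ` hubs (Inl -` P)"

lemma vimage_hat [simp]: "Inl -` hat L = L"
  by (auto simp: hat_def)

lemma FF_hat: "FF (hat L) = (\<lambda>z. Inr (L, z)) ` hubs L"
  by (simp add: FF_def)

lemma hat_subset: "hat L \<subseteq> hat M \<longleftrightarrow> L \<subseteq> M"
proof
  assume "hat L \<subseteq> hat M"
  then have "Inl -` hat L \<subseteq> Inl -` hat M" by blast
  then show "L \<subseteq> M" by simp
qed (auto simp: hat_def)

lemma hat_psubset: "hat L \<subset> hat M \<longleftrightarrow> L \<subset> M"
  by (simp add: less_le_not_le hat_subset)

lemma LL_sub: "L \<in> LL \<Longrightarrow> L \<subseteq> X"
  using tau_sub by (auto simp: LL_def)

lemma LL_ne: "L \<in> LL \<Longrightarrow> L \<noteq> {}"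
  using X_ne tau_self by (auto simp: LL_def)

lemma LL_laminar: "L \<in> LL \<Longrightarrow> M \<in> LL \<Longrightarrow> L \<subseteq> M \<or> M \<subseteq> L \<or> L \<inter> M = {}"
proof -
  assume L: "L \<in> LL" and M: "M \<in> LL"
  show ?thesis
  proof (cases "L = X \<or> M = X")
    case True
    then show ?thesis using LL_sub L M by blast
  next
    case False
    then obtain a b where "a \<in> X" "L = \<tau> a" "b \<in> X" "M = \<tau> b" using L M by (auto simp: LL_def)
    then show ?thesis using tau_laminar[of a b] by simp
  qed
qed

lemma tau_least: "L \<in> LL \<Longrightarrow> x \<in> L \<Longrightarrow> \<tau> x \<subseteq> L"
  by (auto simp: LL_def dest: tau_trans tau_sub)

lemma tau_LL: "x \<in> X \<Longrightarrow> \<tau> x \<in> LL"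
  by (simp add: LL_def)

lemma border_hub:
  assumes "L \<in> LL" "x \<in> border L"
  shows "\<exists>h\<in>FF (hat L). (Inl x, h) \<in> edges"
proof -
  have xX: "x \<in> X" using assms LL_sub by (auto simp: border_def)
  have "L \<in> \<tau> ` X" using assms xX by (auto simp: border_def LL_def)
  then obtain a where a: "a \<in> X" "L = \<tau> a" by blast
  obtain z where z: "z \<in> Z L" "W \<rho> x z" using Z_near[OF a(1), of x] assms a by (auto simp: border_def)
  then have "z \<in> hubs L" using a by (simp add: hubs_def)
  then have "(Inl x, Inr (L, z)) \<in> edges" using z assms by (simp add: edges_def)
  moreover have "Inr (L, z) \<in> FF (hat L)" using \<open>z \<in> hubs L\<close> by (simp add: FF_hat)
  ultimately show ?thesis by blast
qed

text \<open>If the edge goes to a hub of a larger set \<open>M\<close>, then \<open>x\<close> is on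
  the border of \<open>M\<close> but does not own it, since \<tau> \<open>x\<close> is inside
  \<open>L\<close>. So \<open>x\<close> has a neighbour outside \<open>M\<close>, hence outside
  \<open>L\<close>.\<close>

lemma exit_border:
  assumes L: "L \<in> LL" and uv: "(u, v) \<in> edges" "u \<in> hat L" "v \<notin> hat L"
  shows "\<exists>x\<in>border L. u = Inl x"
  using uv(1)[unfolded edges_def]
proof (elim UnE CollectE exE conjE)
  fix x y assume *: "(u, v) = (Inl x, Inl y)" "x \<in> X" "y \<in> X" "W r x y"
  then have "x \<in> L" "y \<notin> L" using uv by (auto simp: hat_def)
  then show ?thesis using * by (auto simp: border_def)
next
  fix x M z assume *: "(u, v) = (Inl x, Inr (M, z))" "M \<in> LL" "x \<in> border M" "z \<in> hubs M" "W \<rho> x z"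
  then have x: "x \<in> L" "\<not> M \<subseteq> L" "x \<in> M" using uv by (auto simp: hat_def border_def)
  then have "L \<subset> M" using LL_laminar[OF L *(2)] by blast
  moreover have "\<tau> x \<noteq> M" using tau_least[OF L x(1)] x by blast
  ultimately show ?thesis using * x by (auto simp: border_def)
next
  fix x M z assume *: "(u, v) = (Inr (M, z), Inl x)" "M \<in> LL" "x \<in> border M" "z \<in> hubs M" "W \<rho> x z"
  then show ?thesis using uv by (auto simp: hat_def border_def)
qed

text \<open>The main case is a neighbour \<open>y\<close> of \<open>x\<close> in
  \<open>M - L\<close>. Comparability gives \<open>x \<in> \<tau> y\<close>, and as nothing lies
  strictly between \<open>L\<close> and \<open>M\<close>, the cell of \<open>y\<close> is
  \<open>M\<close>; so \<open>y\<close> is adjacent to a hub of \<open>M\<close>.\<close>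

lemma exit_parent:
  assumes L: "L \<in> LL" and M: "M \<in> LL" "L \<subset> M" and between: "\<And>J. J \<in> LL \<Longrightarrow> L \<subset> J \<Longrightarrow> \<not> J \<subset> M"
    and uv: "(u, v) \<in> edges" "u \<in> hat L" "v \<notin> hat L"
  shows "(\<exists>h\<in>FF (hat M). (u, h) \<in> edges) \<or> (\<exists>h\<in>FF (hat M). v = h \<or> (v, h) \<in> edges)"
  using uv(1)[unfolded edges_def]
proof (elim UnE CollectE exE conjE)
  fix x y assume *: "(u, v) = (Inl x, Inl y)" "x \<in> X" "y \<in> X" "W r x y"
  then have xy: "x \<in> L" "y \<notin> L" using uv by (auto simp: hat_def)
  show ?thesis
  proof (cases "y \<in> M")
    case False
    then have "x \<in> border M" using xy M * by (auto simp: border_def)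
    then show ?thesis using border_hub[OF M(1)] * by blast
  next
    case True
    have "x \<in> \<tau> y" using tau_comparable[OF *(2-4)] tau_least[OF L xy(1)] xy by blast
    moreover have "\<not> \<tau> y \<subseteq> L" using tau_self[OF *(3)] xy by blast
    ultimately have "L \<subset> \<tau> y" using LL_laminar[OF L tau_LL[OF *(3)]] xy by blast
    then have "\<tau> y = M" using between[OF tau_LL[OF *(3)]] tau_least[OF M(1) True] by blast
    then have "y \<in> border M" using True by (simp add: border_def)
    then show ?thesis using border_hub[OF M(1)] * by blast
  qed
next
  fix x K z assume *: "(u, v) = (Inl x, Inr (K, z))" "K \<in> LL" "x \<in> border K" "z \<in> hubs K" "W \<rho> x z"
  then have x: "x \<in> L" "\<not> K \<subseteq> L" "x \<in> K" using uv by (auto simp: hat_def border_def)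
  then have LK: "L \<subset> K" using LL_laminar[OF L *(2)] by blast
  show ?thesis
  proof (cases "K = M")
    case True
    then show ?thesis using * by (auto simp: FF_hat)
  next
    case False
    have "M \<subseteq> K \<or> K \<subseteq> M" using LL_laminar[OF M(1) *(2)] x M by blast
    then have MK: "M \<subset> K" using between[OF *(2) LK] False by blast
    moreover have "\<tau> x \<noteq> K" using tau_least[OF L x(1)] x by blast
    ultimately have "x \<in> border M" using * x M by (auto simp: border_def)
    then show ?thesis using border_hub[OF M(1)] * by blast
  qed
next
  fix x K z assume *: "(u, v) = (Inr (K, z), Inl x)" "K \<in> LL" "x \<in> border K" "z \<in> hubs K" "W \<rho> x z"
  then show ?thesis using uv by (auto simp: hat_def border_def)
qed

lemma sym_edges: "sym edges"
  unfolding sym_def edges_def using near_sym by blast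

lemma finite_LL: "finite LL"
  using finite_X by (simp add: LL_def)

lemma FF_finite: "finite (FF (hat L))" and FF_card: "card (FF (hat L)) \<le> N"
proof -
  have *: "finite (hubs L) \<and> card (hubs L) \<le> N"
    using finite_Z card_Z by (auto simp: hubs_def)
  then show "finite (FF (hat L))" by (simp add: FF_hat)
  have "card (FF (hat L)) \<le> card (hubs L)" using * by (simp add: FF_hat card_image_le)
  then show "card (FF (hat L)) \<le> N" using * by simp
qed

sublocale tree: tree_space "reach edges" "hat ` LL" FF N
proof (rule tree_space.intro[OF near_space_reach[OF sym_edges]], unfold_locales)
  show "finite (hat ` LL)" using finite_LL by simp
  show "finite (FF P)" "card (FF P) \<le> N" if "P \<in> hat ` LL" for P
    using that FF_finite FF_card by auto
  show "P \<subseteq> Q \<or> Q \<subseteq> P \<or> P \<inter> Q = {}" if PQ: "P \<in> hat ` LL" "Q \<in> hat ` LL" for P Q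
  proof -
    obtain L M where LM: "P = hat L" "L \<in> LL" "Q = hat M" "M \<in> LL" using PQ by blast
    have "hat L \<inter> hat M = {}" if "L \<inter> M = {}"
    proof -
      have "\<not> (K \<subseteq> L \<and> K \<subseteq> M)" if "K \<in> LL" for K
        using LL_ne[OF that] \<open>L \<inter> M = {}\<close> by blast
      then show ?thesis using \<open>L \<inter> M = {}\<close> by (auto simp: hat_def)
    qed
    then show ?thesis using LL_laminar[OF LM(2,4)] LM hat_subset by blast
  qed
  show "FF P \<inter> Q = {}" if PQ: "P \<in> hat ` LL" "Q \<in> hat ` LL" "Q \<subset> P" for P Q
  proof -
    obtain L M where LM: "P = hat L" "L \<in> LL" "Q = hat M" "M \<in> LL" using PQ by blast
    then have "M \<subset> L" using PQ hat_psubset by blast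
    then have "\<not> L \<subseteq> M" by blast
    then have "FF (hat L) \<inter> hat M = {}" by (auto simp: FF_hat) (auto simp: hat_def)
    then show ?thesis using LM by simp
  qed
  show "\<exists>z\<in>FF P. reach edges (k + 1) x z"
    if a: "P \<in> hat ` LL" "x \<in> P" "y \<notin> P" "reach edges k x y" for P x y k
  proof -
    obtain L where L: "P = hat L" "L \<in> LL" using a by blast
    obtain u v i where u: "(u, v) \<in> edges" "u \<in> P" "v \<notin> P" "i < k" "reach edges i x u"
      using reach_exit[OF a(4,2,3)] by metis
    obtain h where "h \<in> FF P" "(u, h) \<in> edges"
      using exit_border[OF L(2) u(1)] border_hub[OF L(2)] u L by blast
    moreover have "reach edges (i + Suc 0) x h"
      using reach_trans[OF u(5) reach_edge] calculation by blast
    then have "reach edges (k + 1) x h" by (rule reach_mono) (use u(4) in simp)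
    ultimately show ?thesis by blast
  qed
  show "\<exists>z\<in>FF Q. reach edges (k + 1) x z"
    if a: "P \<in> hat ` LL" "Q \<in> hat ` LL" "P \<subset> Q" "\<And>J. J \<in> hat ` LL \<Longrightarrow> P \<subset> J \<Longrightarrow> \<not> J \<subset> Q"
      "x \<in> P" "y \<notin> P" "reach edges k x y" for P Q x y k
  proof -
    obtain L M where L: "P = hat L" "L \<in> LL" "Q = hat M" "M \<in> LL" using a by blast
    have LM: "L \<subset> M" using a(3) L hat_psubset by blast
    have between: "\<not> J \<subset> M" if "J \<in> LL" "L \<subset> J" for J
    proof -
      have "hat J \<in> hat ` LL" "P \<subset> hat J" using that L(1) by (simp_all add: hat_psubset)
      from a(4)[OF this] show ?thesis by (simp add: L(3) hat_psubset)
    qed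
    obtain u v i where u: "(u, v) \<in> edges" "u \<in> P" "v \<notin> P" "i < k" "reach edges i x u"
      using reach_exit[OF a(7,5,6)] by metis
    have uv: "reach edges (Suc 0) u v" using u by (rule_tac reach_edge)
    have "(\<exists>h\<in>FF (hat M). (u, h) \<in> edges) \<or> (\<exists>h\<in>FF (hat M). v = h \<or> (v, h) \<in> edges)"
      by (rule exit_parent[OF L(2,4) LM between u(1) u(2)[unfolded L(1)] u(3)[unfolded L(1)]])
    then have "\<exists>h\<in>FF Q. reach edges 2 u h"
    proof (elim disjE bexE)
      fix h assume "h \<in> FF (hat M)" "(u, h) \<in> edges"
      moreover have "reach edges 2 u h" using reach_mono[OF reach_edge, of u h edges 2] calculation by simp
      ultimately show ?thesis using L by blast
    next
      fix h assume "h \<in> FF (hat M)" "v = h"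
      moreover have "reach edges 2 u h" using reach_mono[OF uv, of 2] calculation by simp
      ultimately show ?thesis using L by blast
    next
      fix h assume h: "h \<in> FF (hat M)" "(v, h) \<in> edges"
      have "reach edges (Suc 0 + Suc 0) u h" using reach_trans[OF uv reach_edge[OF h(2)]] .
      then show ?thesis using h L by (auto simp: numeral_2_eq_2)
    qed
    then obtain h where h: "h \<in> FF Q" "reach edges 2 u h" by blast
    \<comment> \<open>The hub can be one edge beyond the exit edge, so the length is
      \<open>i + 2\<close> with \<open>i < k\<close>. This is the origin of \<open>k + 1\<close> in
      \<open>separates_parent\<close>.\<close>
    have "reach edges (k + 1) x h" by (rule reach_mono[OF reach_trans[OF u(5) h(2)]]) (use u(4) in simp)
    then show ?thesis using h by blast
  qed
qed

fun proj :: "'v + 'v set \<times> 'v \<Rightarrow> 'v" where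
  "proj (Inl x) = x" | "proj (Inr (L, z)) = z"

lemma reach_proj: "reach edges k u v \<Longrightarrow> W (k * max \<rho> r) (proj u) (proj v)"
proof (induction k arbitrary: v)
  case 0
  then show ?case using near_refl by simp
next
  case (Suc k)
  then obtain z where z: "reach edges k u z" "z = v \<or> (z, v) \<in> edges" by auto
  have "W (max \<rho> r) (proj z) (proj v)"
  proof (cases "z = v")
    case True
    then show ?thesis using near_mono[OF near_refl] by simp
  next
    case False
    then have "(z, v) \<in> edges" using z by simp
    then have "W r (proj z) (proj v) \<or> W \<rho> (proj z) (proj v)"
      unfolding edges_def using near_sym by auto
    then show ?thesis by (auto elim: near_mono)
  qed
  from near_trans[OF Suc.IH[OF z(1)] this] show ?case by (simp add: add.commute)
qed

lemma conn_Inl: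
  assumes "conn r S x y" "S \<subseteq> X"
  shows "tree.conn 1 (Inl ` S) (Inl x) (Inl y)"
  using assms
proof (induction rule: conn.induct)
  case (conn_refl x)
  then show ?case by (auto intro: tree.conn_refl)
next
  case (conn_step x y z)
  have "y \<in> S" using conn_in[OF conn_step(1)] by simp
  then have "(Inl y, Inl z) \<in> edges" using conn_step by (auto simp: edges_def)
  then have "reach edges 1 (Inl y) (Inl z)" by simp
  then show ?case using conn_step tree.conn_step by blast
qed

text \<open>Steps of length \<open>r\<close> have become edges, so scale 1 suffices. Every point is
  on the border of its own cell and thus adjacent to a hub of it, which gives covering constant
  1.\<close>

theorem hub_two_colouring:
  "\<exists>C. cbd r (tree_bound N N 1 1 * max \<rho> r) (X \<inter> C) \<and> cbd r (tree_bound N N 1 1 * max \<rho> r) (X - C)"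
proof -
  have XLL: "X \<in> LL" by (simp add: LL_def)
  have 1: "tree.instance_on (hat X) (hat ` LL) (Inl ` X)"
    unfolding tree.instance_on_def
  proof (intro conjI ballI impI)
    fix P assume "P \<in> hat ` LL"
    then show "P \<subseteq> hat X" using LL_sub hat_subset by blast
  qed (use XLL in \<open>auto simp: hat_def\<close>)
  have 2: "tree.width_le N (tree_range N N 1 1) (hat ` LL) (Inl ` X)"
    unfolding tree.width_le_def
  proof
    fix P assume P: "P \<in> hat ` LL"
    have "card {z \<in> FF P. \<exists>x\<in>Inl ` X \<inter> P. reach edges (tree_range N N 1 1 + 1) x z} \<le> card (FF P)"
      by (rule card_mono) (use P FF_finite in auto)
    also have "\<dots> \<le> N" using P FF_card by auto
    finally show "card {z \<in> FF P. \<exists>x\<in>Inl ` X \<inter> P. reach edges (tree_range N N 1 1 + 1) x z} \<le> N" .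
  qed
  have 3: "tree.covered 1 (hat ` LL) (Inl ` X)"
    unfolding tree.covered_def
  proof
    fix u :: "'v + 'v set \<times> 'v" assume "u \<in> Inl ` X"
    then obtain x where x: "u = Inl x" "x \<in> X" by blast
    have "x \<in> border (\<tau> x)" using tau_self x by (simp add: border_def)
    then obtain h where h: "h \<in> FF (hat (\<tau> x))" "(Inl x, h) \<in> edges"
      using border_hub[OF tau_LL[OF x(2)]] by blast
    have "reach edges 1 u h" using h x by simp
    then have n: "u \<in> tree.nearF 1 (hat (\<tau> x))" using h by (auto simp: tree.nearF_def)
    have least: "hat (\<tau> x) \<subseteq> P" if P: "P \<in> hat ` LL" "u \<in> P" for P
    proof -
      obtain L where L: "P = hat L" "L \<in> LL" using P by blast
      then have "x \<in> L" using P x by (auto simp: hat_def)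
      then show ?thesis using tau_least L hat_subset by blast
    qed
    show "\<exists>t\<in>hat ` LL. u \<in> t \<and> (\<forall>L\<in>hat ` LL. u \<in> L \<longrightarrow> t \<subseteq> L) \<and>
       (u \<in> tree.nearF 1 t \<or> (\<exists>K. tree.child K t \<and> K \<notin> hat ` LL \<and> u \<in> K \<and> u \<in> tree.nearF 1 K))"
      using tau_LL[OF x(2)] n least tau_self[OF x(2)] x by (intro bexI[of _ "hat (\<tau> x)"]) (auto simp: hat_def)
  qed
  let ?D = "tree_bound N N 1 1"
  obtain C where C: "tree.cbd 1 ?D (Inl ` X \<inter> C)" "tree.cbd 1 ?D (Inl ` X - C)"
    using tree.tree_two_colouring[OF 1 2 3] by blast
  have *: "cbd r (?D * max \<rho> r) S" if S: "S \<subseteq> X" "tree.cbd 1 ?D (Inl ` S)" for S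
    unfolding cbd_def
  proof (intro allI impI)
    fix x y assume "conn r S x y"
    then have "reach edges ?D (Inl x) (Inl y)" using conn_Inl[OF _ S(1)] S(2) unfolding tree.cbd_def by blast
    from reach_proj[OF this] show "W (?D * max \<rho> r) x y" by simp
  qed
  have "Inl ` X \<inter> C = Inl ` (X \<inter> Inl -` C)" "Inl ` X - C = Inl ` (X - Inl -` C)" by auto
  then show ?thesis using C *[of "X \<inter> Inl -` C"] *[of "X - Inl -` C"] by (intro exI[of _ "Inl -` C"]) auto
qed

end

section \<open>Shifted grids, slabs and hollow convex sets\<close>

definition cell :: "real \<Rightarrow> nat \<Rightarrow> 'a::euclidean_space \<Rightarrow> 'a \<Rightarrow> int" where
  "cell s i p = (\<lambda>b. if b \<in> Basis then \<lfloor>p \<bullet> b / s - real i / real (DIM('a) + 1)\<rfloor> else 0)"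

lemma cell_eq_iff:
  fixes p q :: "'a::euclidean_space"
  shows "cell s i p = cell s i q \<longleftrightarrow> (\<forall>b\<in>Basis.
    \<lfloor>p \<bullet> b / s - real i / real (DIM('a) + 1)\<rfloor> = \<lfloor>q \<bullet> b / s - real i / real (DIM('a) + 1)\<rfloor>)"
  by (auto simp: cell_def fun_eq_iff)

text \<open>The ratio \<open>d + 2\<close> is congruent to 1 modulo \<open>d + 1\<close>, so scaling a grid by this factor
  maps the shift by \<open>i / (d + 1)\<close> to the same shift up to an integer.\<close>

lemma cell_nested:
  fixes p q :: "'a::euclidean_space"
  assumes s: "s > 0" and eq: "cell s i p = cell s i q"
  shows "cell (real (DIM('a) + 2) * s) i p = cell (real (DIM('a) + 2) * s) i q"
proof -
  let ?n = "DIM('a) + 1"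
  have gen: "x / ((n + 1) * s) - j / n = (x / s - j / n - j) / (n + 1)" if "n > 0" "s > 0" for n s x j :: real
  proof -
    have e: "x / s - j / n - j = x / s - j / n * (n + 1)" using that by (simp add: distrib_left)
    have "(x / s - j / n - j) / (n + 1) = x / s / (n + 1) - j / n"
      unfolding e using that by (simp add: diff_divide_distrib)
    then show ?thesis by (simp add: mult.commute)
  qed
  have *: "\<lfloor>x / (real (?n + 1) * s) - real i / real ?n\<rfloor> =
      (\<lfloor>x / s - real i / real ?n\<rfloor> - int i) div int (?n + 1)" for x
  proof -
    have "x / (real (?n + 1) * s) - real i / real ?n
        = (x / s - real i / real ?n - real i) / real_of_int (int (?n + 1))"
      using gen[of "real ?n" s x "real i"] s by simp
    then have "\<lfloor>x / (real (?n + 1) * s) - real i / real ?n\<rfloor> =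
       \<lfloor>x / s - real i / real ?n - real i\<rfloor> div int (?n + 1)"
      by (simp only: floor_divide_real_eq_div[OF of_nat_0_le_iff])
    also have "\<lfloor>x / s - real i / real ?n - real i\<rfloor> = \<lfloor>x / s - real i / real ?n\<rfloor> - int i"
      by linarith
    finally show ?thesis .
  qed
  show ?thesis using eq * by (simp add: cell_eq_iff)
qed

lemma cell_nested_power:
  fixes p q :: "'a::euclidean_space"
  assumes s: "s > 0" and eq: "cell (s * real (DIM('a) + 2) ^ j) i p = cell (s * real (DIM('a) + 2) ^ j) i q"
    and "j \<le> k"
  shows "cell (s * real (DIM('a) + 2) ^ k) i p = cell (s * real (DIM('a) + 2) ^ k) i q"
  using assms(3)
proof (induction k)
  case 0
  then show ?case using eq by simp
next
  case (Suc k)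
  show ?case
  proof (cases "j = Suc k")
    case True
    then show ?thesis using eq by simp
  next
    case False
    then have "cell (s * real (DIM('a) + 2) ^ k) i p = cell (s * real (DIM('a) + 2) ^ k) i q"
      using Suc by simp
    moreover have "s * real (DIM('a) + 2) ^ k > 0" using s by simp
    ultimately show ?thesis using cell_nested[of "s * real (DIM('a) + 2) ^ k" i p q]
      by (simp add: mult_ac)
  qed
qed

lemma cell_diff:
  fixes p q :: "'a::euclidean_space"
  assumes s: "s > 0" and eq: "cell s i p = cell s i q" and b: "b \<in> Basis"
  shows "\<bar>(p - q) \<bullet> b\<bar> < s"
proof -
  have "\<lfloor>p \<bullet> b / s - real i / real (DIM('a) + 1)\<rfloor> = \<lfloor>q \<bullet> b / s - real i / real (DIM('a) + 1)\<rfloor>"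
    using eq b by (simp only: cell_eq_iff)
  then have "\<bar>p \<bullet> b / s - q \<bullet> b / s\<bar> < 1" by linarith
  then have "\<bar>(p \<bullet> b - q \<bullet> b) / s\<bar> < 1" by (simp add: diff_divide_distrib)
  then show ?thesis using s by (simp add: inner_diff_left)
qed

lemma floor_neq_between:
  assumes "\<lfloor>x\<rfloor> \<noteq> \<lfloor>y\<rfloor>"
  shows "\<exists>m::int. \<bar>real_of_int m - x\<bar> \<le> \<bar>x - y\<bar>"
proof (cases "x < y")
  case True
  then have "\<lfloor>x\<rfloor> < \<lfloor>y\<rfloor>" using assms floor_mono[of x y] by simp
  then show ?thesis using True by (intro exI[of _ "\<lfloor>y\<rfloor>"]) linarith
next
  case False
  then have "\<lfloor>y\<rfloor> < \<lfloor>x\<rfloor>" using assms floor_mono[of y x] by simp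
  then show ?thesis using False by (intro exI[of _ "\<lfloor>x\<rfloor>"]) linarith
qed

text \<open>Each coordinate hyperplane direction spoils at most one of the \<open>d + 1\<close> shifts.\<close>

lemma cell_padded:
  fixes p :: "'a::euclidean_space"
  assumes s: "s > 0"
  shows "\<exists>i\<le>DIM('a). \<forall>q. norm (q - p) < s / real (2 * (DIM('a) + 1)) \<longrightarrow> cell s i q = cell s i p"
proof (rule ccontr)
  let ?n = "DIM('a) + 1"
  define bad where "bad b = {i. i \<le> DIM('a) \<and> (\<exists>m::int. \<bar>real_of_int m - (p \<bullet> b / s - real i / real ?n)\<bar> < 1 / real (2 * ?n))}"
    for b :: 'a
  assume no: "\<not> ?thesis"
  have "{..DIM('a)} \<subseteq> (\<Union>b\<in>Basis. bad b)"
  proof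
    fix i assume "i \<in> {..DIM('a)}"
    then have i: "i \<le> DIM('a)" by simp
    then obtain q where q: "norm (q - p) < s / real (2 * ?n)" "cell s i q \<noteq> cell s i p" using no by blast
    then obtain b where b: "b \<in> Basis"
      "\<lfloor>p \<bullet> b / s - real i / real ?n\<rfloor> \<noteq> \<lfloor>q \<bullet> b / s - real i / real ?n\<rfloor>"
      unfolding cell_eq_iff by metis
    obtain m :: int where m: "\<bar>real_of_int m - (p \<bullet> b / s - real i / real ?n)\<bar>
       \<le> \<bar>(p \<bullet> b / s - real i / real ?n) - (q \<bullet> b / s - real i / real ?n)\<bar>"
      using floor_neq_between[OF b(2)] by blast
    have "\<bar>(p \<bullet> b / s - real i / real ?n) - (q \<bullet> b / s - real i / real ?n)\<bar> = \<bar>(q - p) \<bullet> b\<bar> / s"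
      using s by (simp add: inner_diff_left diff_divide_distrib[symmetric] abs_minus_commute)
    also have "\<dots> \<le> norm (q - p) / s"
      using s Basis_le_norm[OF b(1), of "q - p"] by (simp add: divide_right_mono)
    also have "\<dots> < 1 / real (2 * ?n)"
      using q(1) s by (simp add: field_simps)
    finally have "\<bar>real_of_int m - (p \<bullet> b / s - real i / real ?n)\<bar> < 1 / real (2 * ?n)"
      using m by (rule order.strict_trans1[rotated])
    then have "i \<in> bad b" using i unfolding bad_def by blast
    then show "i \<in> (\<Union>b\<in>Basis. bad b)" using b by blast
  qed
  then have "card {..DIM('a)} \<le> card (\<Union>b\<in>Basis. bad b)"
    by (intro card_mono) (auto simp: bad_def)
  also have "\<dots> \<le> (\<Sum>b\<in>Basis. card (bad b))" by (rule card_UN_le) simp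
  also have "\<dots> \<le> (\<Sum>b\<in>(Basis::'a set). 1)"
  proof (rule sum_mono)
    fix b :: 'a
    \<comment> \<open>For two bad shifts in one direction, \<open>j - i\<close> differs from a
      multiple of \<open>d + 1\<close> by less than 1. So it is a multiple, although it is positive
      and at most \<open>d\<close>.\<close>
    have uniq: "\<not> i < j" if ij: "i \<in> bad b" "j \<in> bad b" for i j
    proof
      assume less: "i < j"
      obtain m m' :: int where m: "\<bar>real_of_int m - (p \<bullet> b / s - real i / real ?n)\<bar> < 1 / real (2 * ?n)"
        "\<bar>real_of_int m' - (p \<bullet> b / s - real j / real ?n)\<bar> < 1 / real (2 * ?n)"
        using ij by (auto simp: bad_def)
      define x where "x = real_of_int (m' - m) - (real i / real ?n - real j / real ?n)"
      have "\<bar>x\<bar> < 1 / real (2 * ?n) + 1 / real (2 * ?n)"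
        using m unfolding x_def of_int_diff by linarith
      also have "\<dots> = 1 / real ?n" by (simp add: field_simps)
      finally have "\<bar>x\<bar> * real ?n < 1" by (simp add: field_simps)
      moreover have "x * real ?n = real_of_int ((m' - m) * int ?n + (int j - int i))"
      proof -
        have "(u - (v / n - w / n)) * n = u * n + (w - v)" if "n > 0" for u v w n :: real
          using that by (simp add: left_diff_distrib)
        from this[of "real ?n"] show ?thesis by (simp add: x_def)
      qed
      ultimately have "\<bar>real_of_int ((m' - m) * int ?n + (int j - int i))\<bar> < 1"
        by (metis abs_mult abs_of_nat)
      then have z: "(m' - m) * int ?n + (int j - int i) = 0" by linarith
      then have "int ?n dvd int j - int i" by (metis dvd_add_right_iff dvd_triv_right dvd_0_right)
      moreover have "int j - int i < int ?n" using ij by (auto simp: bad_def)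
      ultimately show False using less zdvd_not_zless[of "int j - int i" "int ?n"] by simp
    qed
    have fin: "finite (bad b)" by (simp add: bad_def)
    have "is_singleton (bad b) \<or> bad b = {}"
      using uniq by (metis is_singletonI' linorder_neqE_nat)
    then show "card (bad b) \<le> 1" by (auto simp: is_singleton_altdef)
  qed
  also have "\<dots> = DIM('a)" by simp
  finally show False by simp
qed

section \<open>Heights, separation and nesting of convex sets\<close>

lemma height_le:
  assumes "h \<ge> 0" "norm u = 1" "\<And>x. x \<in> X \<Longrightarrow> c \<le> u \<bullet> x \<and> u \<bullet> x \<le> c + h"
  shows "height X \<le> h"
  unfolding height_def
  by (rule cInf_lower) (use assms in \<open>auto intro!: bdd_belowI[of _ 0]\<close>)

text \<open>If the shrunken copy of \<open>K\<close> stays close to \<open>K'\<close>, a hyperplane separating \<open>K\<close> from \<open>K'\<close>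
  would confine the copy, and hence \<open>K\<close>, to a thin slab.\<close>

lemma convex_meet:
  fixes K K' :: "'a::euclidean_space set"
  assumes K: "convex K" "compact K" and K': "convex K'" "compact K'"
    and q: "q \<in> K" and t: "0 < t" "t \<le> 1"
    and close: "\<And>z. z \<in> K \<Longrightarrow> \<exists>y\<in>K'. norm ((q + t *\<^sub>R (z - q)) - y) \<le> \<delta>"
    and asp: "diameter K \<le> \<alpha> * height K" "0 \<le> \<alpha>" and small: "\<alpha> * \<delta> < t * diameter K"
  shows "K \<inter> K' \<noteq> {}"
proof
  assume disj: "K \<inter> K' = {}"
  have ne: "K \<noteq> {}" "K' \<noteq> {}" using q close by auto
  obtain a b where ab: "\<And>x. x \<in> K \<Longrightarrow> a \<bullet> x < b" "\<And>x. x \<in> K' \<Longrightarrow> b < a \<bullet> x"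
    using separating_hyperplane_compact_closed[OF K ne(1) K'(1) compact_imp_closed[OF K'(2)] disj] by metis
  have "a \<noteq> 0" using ab(1)[OF q] ab(2) ne(2) by force
  define u where "u = a /\<^sub>R norm a"
  define \<beta> where "\<beta> = b / norm a"
  have nu: "norm u = 1" using \<open>a \<noteq> 0\<close> by (simp add: u_def)
  have u1: "u \<bullet> x < \<beta>" if "x \<in> K" for x
    using ab(1)[OF that] \<open>a \<noteq> 0\<close> by (simp add: u_def \<beta>_def field_simps)
  have u2: "\<beta> < u \<bullet> x" if "x \<in> K'" for x
    using ab(2)[OF that] \<open>a \<noteq> 0\<close> by (simp add: u_def \<beta>_def field_simps)
  obtain y0 where "norm ((q + t *\<^sub>R (q - q)) - y0) \<le> \<delta>" using close[OF q] by blast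
  then have \<delta>: "\<delta> \<ge> 0" using norm_ge_zero order_trans by blast
  \<comment> \<open>The slab of the contracted copy, pulled back through the contraction by
    \<open>t\<close> towards \<open>q\<close>.\<close>
  define c where "c = (\<beta> - \<delta> - (1 - t) * (u \<bullet> q)) / t"
  have "height K \<le> \<delta> / t"
  proof (rule height_le[OF _ nu])
    show "0 \<le> \<delta> / t" using \<delta> t by simp
    fix z assume z: "z \<in> K"
    let ?x = "q + t *\<^sub>R (z - q)"
    have "?x = (1 - t) *\<^sub>R q + t *\<^sub>R z" by (simp add: algebra_simps)
    then have "?x \<in> K" using K(1) q z t by (simp add: convexD)
    then have up: "u \<bullet> ?x < \<beta>" using u1 by blast
    obtain y where y: "y \<in> K'" "norm (?x - y) \<le> \<delta>" using close[OF z] by blast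
    have "\<bar>u \<bullet> (?x - y)\<bar> \<le> \<delta>" using Cauchy_Schwarz_ineq2[of u "?x - y"] y(2) nu by simp
    then have low: "\<beta> - \<delta> < u \<bullet> ?x" using u2[OF y(1)] by (simp add: inner_diff_right)
    have e: "u \<bullet> ?x = (1 - t) * (u \<bullet> q) + t * (u \<bullet> z)" by (simp add: inner_simps algebra_simps)
    show "c \<le> u \<bullet> z \<and> u \<bullet> z \<le> c + \<delta> / t"
      using up low t unfolding e c_def by (simp add: field_simps)
  qed
  then have "\<alpha> * height K \<le> \<alpha> * (\<delta> / t)" using asp(2) by (rule mult_left_mono)
  then have "diameter K \<le> \<alpha> * \<delta> / t" using asp(1) by simp
  then have "t * diameter K \<le> \<alpha> * \<delta>" using t(1) by (simp add: field_simps)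
  then show False using small by simp
qed

text \<open>A connected set that misses a frontier is inside or outside. If \<open>S\<close> is
  outside \<open>K'\<close>, then the convex set \<open>K'\<close> misses the frontier of
  \<open>K\<close> and meets \<open>K\<close>, so it lies in the interior of
  \<open>K\<close>.\<close>

lemma hollow_nested:
  fixes K K' :: "'a::euclidean_space set"
  assumes K: "convex K" "frontier K \<subseteq> S" "S \<subseteq> K" "connected S" "S \<noteq> {}"
    and K': "convex K'" "frontier K' \<subseteq> S'" "S' \<subseteq> K'" "connected S'" "S' \<noteq> {}"
    and meet: "K \<inter> K' \<noteq> {}" and disj: "S \<inter> S' = {}"
  shows "S \<subseteq> interior K' \<or> S' \<subseteq> interior K"
proof -
  have *: "A \<subseteq> interior B \<or> A \<inter> B = {}" if "connected A" "A \<inter> frontier B = {}" for A B :: "'a set"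
    using connected_Int_frontier[OF that(1), of B] that(2) closure_subset[of B]
    unfolding frontier_def by blast
  have 1: "S \<subseteq> interior K' \<or> S \<inter> K' = {}" using * K(4) K'(2) disj by blast
  have "S' \<subseteq> interior K \<or> S \<subseteq> interior K'" if "S \<inter> K' = {}"
  proof -
    have "K' \<inter> frontier K = {}" using that K(2) by blast
    then have "K' \<subseteq> interior K" using *[OF convex_connected[OF K'(1)]] meet by blast
    then show ?thesis using K'(3) by blast
  qed
  then show ?thesis using 1 by blast
qed

text \<open>A point of maximal norm in \<open>K\<close> is on its frontier, hence interior to
  \<open>K'\<close>, so \<open>K'\<close> has a point of strictly larger norm; and
  conversely.\<close>

lemma not_mutually_inside:
  fixes K K' :: "'a::euclidean_space set"
  assumes "compact K" "K \<noteq> {}" "compact K'" "K' \<noteq> {}"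
    and "frontier K \<subseteq> interior K'" "frontier K' \<subseteq> interior K"
  shows False
proof -
  have *: "\<exists>y\<in>K'. norm x < norm y"
    if "x \<in> K" "\<And>z. z \<in> K \<Longrightarrow> norm z \<le> norm x" "frontier K \<subseteq> interior K'"
    for K K' :: "'a set" and x
  proof -
    have grow: "\<exists>y\<in>A. norm x < norm y" if x: "x \<in> interior A" for A
    proof -
      obtain e where e: "e > 0" "cball x e \<subseteq> A" using x mem_interior_cball by blast
      show ?thesis
      proof (cases "x = 0")
        case True
        obtain b :: 'a where "b \<in> Basis" using nonempty_Basis by blast
        then have "e *\<^sub>R b \<in> A" "norm (e *\<^sub>R b) > 0" using e True by auto
        then show ?thesis using True by (metis norm_zero)
      next
        case False
        let ?y = "(1 + e / norm x) *\<^sub>R x"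
        have "dist x ?y = e" using False e by (simp add: dist_norm scaleR_left_distrib)
        then have "?y \<in> A" using e by auto
        moreover have "norm ?y = norm x + e" using False e by (simp add: field_simps)
        ultimately show ?thesis using e(1) by (metis less_add_same_cancel1)
      qed
    qed
    have "x \<notin> interior K" using grow[of K] that(2) by force
    then have "x \<in> frontier K" using that(1) closure_subset by (auto simp: frontier_def)
    then show ?thesis using grow that(3) by blast
  qed
  obtain x where x: "x \<in> K" "\<And>z. z \<in> K \<Longrightarrow> norm z \<le> norm x"
    using continuous_attains_sup[OF assms(1,2), of norm] continuous_on_norm_id by blast
  obtain y where y: "y \<in> K'" "\<And>z. z \<in> K' \<Longrightarrow> norm z \<le> norm y"
    using continuous_attains_sup[OF assms(3,4), of norm] continuous_on_norm_id by blast
  show False using *[OF x assms(5)] *[OF y assms(6)] x(2) y(2) by force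
qed

lemma finite_pos_lower_bound:
  fixes A :: "real set"
  assumes "finite A"
  shows "\<exists>e>0. \<forall>a\<in>A. 0 < a \<longrightarrow> e < a"
  using assms
proof (induction rule: finite_induct)
  case empty
  then show ?case by (auto intro: exI[of _ 1])
next
  case (insert a A)
  then obtain e where e: "e > 0" "\<forall>a\<in>A. 0 < a \<longrightarrow> e < a" by blast
  show ?case
  proof (cases "a > 0")
    case True
    then show ?thesis using e by (intro exI[of _ "min e (a / 2)"]) auto
  next
    case False
    then show ?thesis using e by (intro exI[of _ e]) auto
  qed
qed

section \<open>Scales and cells of hollow convex sets\<close>

definition meets :: "'v set \<Rightarrow> ('v \<Rightarrow> 'a set) \<Rightarrow> 'v rel" where
  "meets V S = {(u, v). u \<in> V \<and> v \<in> V \<and> u \<noteq> v \<and> S u \<inter> S v \<noteq> {}}"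

lemma sym_meets: "sym (meets V S)"
  by (auto simp: sym_def meets_def)

locale hollow_system =
  fixes V :: "'v set" and K S :: "'v \<Rightarrow> 'a::euclidean_space set" and \<alpha> :: real and v0 :: 'v
  assumes finite_V: "finite V" and root: "v0 \<in> V"
    and convex_K: "v \<in> V \<Longrightarrow> convex (K v)" and compact_K: "v \<in> V \<Longrightarrow> compact (K v)"
    and aspect: "v \<in> V \<Longrightarrow> diameter (K v) \<le> \<alpha> * height (K v)"
    and frontier_S: "v \<in> V \<Longrightarrow> frontier (K v) \<subseteq> S v" and S_sub: "v \<in> V \<Longrightarrow> S v \<subseteq> K v"
    and connected_S: "v \<in> V \<Longrightarrow> connected (S v)" and S_ne: "v \<in> V \<Longrightarrow> S v \<noteq> {}"
    and alpha: "\<alpha> \<ge> 1"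
    and linked: "u \<in> V \<Longrightarrow> v \<in> V \<Longrightarrow> \<exists>n. reach (meets V S) n u v"
begin

abbreviation "G \<equiv> reach (meets V S)"

sublocale near_space G
  by (rule near_space_reach[OF sym_meets])

lemma reach_V: "G n u v \<Longrightarrow> u \<in> V \<Longrightarrow> v \<in> V"
proof (induction n arbitrary: v)
  case (Suc n)
  then obtain z where z: "G n u z" "z = v \<or> (z, v) \<in> meets V S" by auto
  have "z \<in> V" by (rule Suc.IH[OF z(1) Suc.prems(2)])
  then show ?case using z(2) unfolding meets_def by blast
qed simp

definition depth :: "'v \<Rightarrow> nat" where "depth v = (LEAST n. G n v0 v)"

lemma depth_reach: "v \<in> V \<Longrightarrow> G (depth v) v0 v"
  unfolding depth_def using linked[OF root] by (rule LeastI_ex)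

lemma depth_le: "G n v0 v \<Longrightarrow> depth v \<le> n"
  unfolding depth_def by (rule Least_le)

lemma depth_lipschitz: "u \<in> V \<Longrightarrow> G n u v \<Longrightarrow> depth v \<le> depth u + n"
  using near_trans[OF depth_reach] depth_le by blast

lemma G_close: "u \<in> V \<Longrightarrow> v \<in> V \<Longrightarrow> S u \<inter> S v \<noteq> {} \<Longrightarrow> G 1 u v"
  by (auto simp: meets_def)

lemma edge_meet: "(u, v) \<in> meets V S \<Longrightarrow> u \<in> V \<and> v \<in> V \<and> S u \<inter> S v \<noteq> {}"
  by (simp add: meets_def)

lemma crosses_frontier:
  assumes "u \<in> V" "v \<in> V" "w \<in> V" "S u \<inter> S v \<noteq> {}" "S u \<subseteq> interior (K w)" "\<not> S v \<subseteq> interior (K w)"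
  shows "G 1 v w"
proof -
  have "S v \<inter> frontier (interior (K w)) \<noteq> {}"
    by (rule connected_Int_frontier[OF connected_S]) (use assms in auto)
  moreover have "frontier (interior (K w)) \<subseteq> S w"
    using frontier_interior_subset frontier_S[OF assms(3)] by blast
  ultimately show ?thesis using G_close assms by blast
qed

text \<open>Seen from the root, a path to the inner one of two nested sets (or, if the root is inside
  both, to the outer one) has to cross the other set.\<close>

lemma nested_close_aux:
  assumes w: "w1 \<in> V" "w2 \<in> V" and inside: "S w1 \<subseteq> interior (K w2)"
    and side: "S v0 \<subseteq> interior (K w1) \<longleftrightarrow> S v0 \<subseteq> interior (K w2)"
    and m: "depth w1 \<le> depth w2 + m" "depth w2 \<le> depth w1 + m"
  shows "G (m + 2) w1 w2"
proof (cases "S v0 \<subseteq> interior (K w2)")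
  case False
  obtain u v i where e: "(u, v) \<in> meets V S" "u \<in> {z. \<not> S z \<subseteq> interior (K w2)}"
    "v \<notin> {z. \<not> S z \<subseteq> interior (K w2)}" "i < depth w1" "G i v0 u" "G (depth w1 - Suc i) v w1"
    using reach_exit[OF depth_reach[OF w(1)], of "{z. \<not> S z \<subseteq> interior (K w2)}"] False inside by auto
  have uv: "u \<in> V" "v \<in> V" "S v \<inter> S u \<noteq> {}" using edge_meet[OF e(1)] by auto
  have c: "G 1 u w2" using crosses_frontier[of v u w2] uv w e by blast
  have "G (i + 1) v0 w2" using near_trans[OF e(5) c] .
  then have "depth w2 \<le> i + 1" by (rule depth_le)
  moreover have "G (depth w1 - Suc i + 1) w1 u"
    using near_trans[OF near_sym[OF e(6)] near_sym[OF G_close[OF uv(1,2)]]] uv by blast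
  then have "G (depth w1 - Suc i + 1 + 1) w1 w2" using near_trans c by blast
  \<comment> \<open>As \<open>depth w2 \<le> i + 1\<close>, at most \<open>m\<close> steps lead from
    \<open>v\<close> to \<open>w1\<close>; two more connect \<open>v\<close> to
    \<open>w2\<close>.\<close>
  ultimately show ?thesis by (elim near_mono) (use m e(4) in linarith)
next
  case True
  then have in1: "S v0 \<subseteq> interior (K w1)" using side by blast
  \<comment> \<open>This ensures that the walk from the root to \<open>w2\<close> has to leave the
    inner set.\<close>
  have "\<not> S w2 \<subseteq> interior (K w1)"
  proof
    assume "S w2 \<subseteq> interior (K w1)"
    then have "frontier (K w1) \<subseteq> interior (K w2)" "frontier (K w2) \<subseteq> interior (K w1)"
      using inside frontier_S w by blast+
    moreover have "K w1 \<noteq> {}" "K w2 \<noteq> {}" using S_ne S_sub w by blast+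
    ultimately show False using not_mutually_inside[of "K w1" "K w2"] compact_K w by blast
  qed
  then obtain u v i where e: "(u, v) \<in> meets V S" "S u \<subseteq> interior (K w1)"
    "\<not> S v \<subseteq> interior (K w1)" "i < depth w2" "G i v0 u" "G (depth w2 - Suc i) v w2"
    using reach_exit[OF depth_reach[OF w(2)], of "{z. S z \<subseteq> interior (K w1)}"] in1 by auto
  have uv: "u \<in> V" "v \<in> V" "S u \<inter> S v \<noteq> {}" using edge_meet[OF e(1)] by auto
  have c: "G 1 v w1" using crosses_frontier[of u v w1] uv w e by blast
  have "G (i + 1) v0 v" using near_trans[OF e(5) G_close[OF uv]] .
  then have "G (i + 1 + 1) v0 w1" using near_trans c by blast
  then have "depth w1 \<le> i + 1 + 1" by (rule depth_le)
  moreover have "G (1 + (depth w2 - Suc i)) w1 w2" using near_trans[OF near_sym[OF c] e(6)] .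
  ultimately show ?thesis by (elim near_mono) (use m e(4) in linarith)
qed

lemma nested_close:
  assumes w: "w1 \<in> V" "w2 \<in> V" and meet: "K w1 \<inter> K w2 \<noteq> {}"
    and side: "S v0 \<subseteq> interior (K w1) \<longleftrightarrow> S v0 \<subseteq> interior (K w2)"
    and m: "depth w1 \<le> depth w2 + m" "depth w2 \<le> depth w1 + m"
  shows "G (m + 2) w1 w2"
proof (cases "S w1 \<inter> S w2 = {}")
  case True
  have "S w1 \<subseteq> interior (K w2) \<or> S w2 \<subseteq> interior (K w1)"
    by (rule hollow_nested)
      (use w meet True convex_K frontier_S S_sub connected_S S_ne in auto)
  then show ?thesis
    using nested_close_aux[OF w _ side m] nested_close_aux[OF w(2,1) _ side[symmetric] m(2,1)] near_sym by blast
next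
  case False
  show ?thesis by (rule near_mono[OF G_close[OF w False]]) simp
qed

definition pt :: "'v \<Rightarrow> 'a" where "pt v = (SOME p. p \<in> S v)"

lemma pt_S: "v \<in> V \<Longrightarrow> pt v \<in> S v"
  unfolding pt_def using S_ne by (metis some_in_eq)

lemma pt_K: "v \<in> V \<Longrightarrow> pt v \<in> K v"
  using pt_S S_sub by blast

lemma diam_K: "v \<in> V \<Longrightarrow> p \<in> K v \<Longrightarrow> q \<in> K v \<Longrightarrow> norm (p - q) \<le> diameter (K v)"
  using diameter_bounded_bound[OF compact_imp_bounded[OF compact_K], of v p q] by (simp add: dist_norm)

end

text \<open>Side of a cell in units of its level. The padding, a fraction
  \<open>1 / (2 * (d + 1))\<close> of the side, becomes \<open>r + 2\<close> units; a walk of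
  \<open>r\<close> steps needs at most \<open>r + 1\<close>.\<close>

definition grid_factor :: "nat \<Rightarrow> nat \<Rightarrow> real" where
  "grid_factor d r = real (2 * (d + 1) * (r + 2))"

definition mesh_number :: "nat \<Rightarrow> real \<Rightarrow> nat \<Rightarrow> nat" where
  "mesh_number d \<alpha> r =
     nat \<lceil>(grid_factor d r + 2 * real r + 1) * (2 * real d * \<alpha> * real (d + 2))\<rceil> + 1"

text \<open>The number of records: sets of mesh cells with coordinates of absolute value at most
  \<open>mesh_number d \<alpha> r\<close>, and a bit for the side of the root.\<close>

definition hub_number :: "nat \<Rightarrow> real \<Rightarrow> nat \<Rightarrow> nat" where
  "hub_number d \<alpha> r = 2 ^ ((2 * mesh_number d \<alpha> r + 1) ^ d) * 2"

section \<open>Scales, levels and the forest of cells\<close>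

locale hollow_annulus = hollow_system V K S \<alpha> v0
  for V :: "'v set" and K S :: "'v \<Rightarrow> 'a::euclidean_space set" and \<alpha> :: real and v0 :: 'v +
  fixes d :: nat and lam :: real and r l a :: nat and \<epsilon> :: real
  assumes d_eq: "d = DIM('a)" and lam_eq: "lam = real (d + 2)" and eps_pos: "\<epsilon> > 0"
    and eps_pt: "u \<in> V \<Longrightarrow> v \<in> V \<Longrightarrow> pt u \<noteq> pt v \<Longrightarrow>
       (real d * grid_factor d r) * \<epsilon> < norm (pt u - pt v)"
begin

definition scale :: "'v \<Rightarrow> nat" where "scale v = (LEAST k. diameter (K v) \<le> \<epsilon> * lam ^ k)"

lemma lam_gt1: "lam > 1" by (simp add: lam_eq)

lemma scale_diam: "diameter (K v) \<le> \<epsilon> * lam ^ scale v"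
proof -
  obtain k where "diameter (K v) / \<epsilon> < lam ^ k" using real_arch_pow[OF lam_gt1] by blast
  then have "diameter (K v) \<le> \<epsilon> * lam ^ k" using eps_pos by (simp add: field_simps)
  then show ?thesis unfolding scale_def by (rule LeastI)
qed

lemma unit_mono: "j \<le> k \<Longrightarrow> \<epsilon> * lam ^ j \<le> \<epsilon> * lam ^ k"
  using eps_pos lam_gt1 by (simp add: power_increasing)

lemma unit_pos: "0 < \<epsilon> * lam ^ k"
  using eps_pos lam_gt1 by simp

lemma scale_le_diam: "scale v \<le> k \<Longrightarrow> diameter (K v) \<le> \<epsilon> * lam ^ k"
  using scale_diam unit_mono order_trans by blast

lemma scale_gt_diam: "k < scale v \<Longrightarrow> \<epsilon> * lam ^ k < diameter (K v)"
  unfolding scale_def using not_less_Least by fastforce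

text \<open>The walk is followed to its end or to the first vertex of scale above \<open>k\<close>.
  Every set traversed before has diameter at most one unit.\<close>

lemma drift:
  assumes "G n x w" "x \<in> V" "p \<in> S x"
  shows "\<exists>w' q. w' \<in> V \<and> G n x w' \<and> q \<in> S w' \<and> norm (p - q) \<le> real n * (\<epsilon> * lam ^ k) \<and>
    (w' = w \<or> k < scale w')"
  using assms(1)
proof (induction n arbitrary: w)
  case 0
  then show ?case using assms by auto
next
  case (Suc n)
  then obtain z where z: "G n x z" "z = w \<or> (z, w) \<in> meets V S" by auto
  obtain w' q where w': "w' \<in> V" "G n x w'" "q \<in> S w'" "norm (p - q) \<le> real n * (\<epsilon> * lam ^ k)"
    "w' = z \<or> k < scale w'"
    using Suc.IH[OF z(1)] by blast
  have le: "real n * (\<epsilon> * lam ^ k) \<le> real (Suc n) * (\<epsilon> * lam ^ k)"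
    using unit_pos[of k] by (intro mult_right_mono) auto
  have up: "G (Suc n) x w'" by (rule near_mono[OF w'(2)]) simp
  show ?case
  proof (cases "k < scale w' \<or> z = w")
    case True
    then show ?thesis using w' up le by (intro exI[of _ w'] exI[of _ q]) auto
  next
    case False
    then have "w' = z" "(z, w) \<in> meets V S" using w'(5) z(2) by auto
    then obtain q' where q': "q' \<in> S z" "q' \<in> S w" "w \<in> V" "z \<in> V" using edge_meet by blast
    have "norm (q - q') \<le> diameter (K z)"
      using diam_K[OF q'(4)] w'(3) \<open>w' = z\<close> q' S_sub by blast
    also have "\<dots> \<le> \<epsilon> * lam ^ k" using scale_le_diam False \<open>w' = z\<close> by auto
    finally have "norm (p - q') \<le> real n * (\<epsilon> * lam ^ k) + \<epsilon> * lam ^ k"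
      using w'(4) norm_triangle_ineq[of "p - q" "q - q'"] by simp
    then have "norm (p - q') \<le> real (Suc n) * (\<epsilon> * lam ^ k)" by (simp add: algebra_simps)
    then show ?thesis using q' Suc.prems by blast
  qed
qed

definition level :: "'v \<Rightarrow> nat" where "level x = Max (scale ` {y \<in> V. G r x y})"

lemma level_ge: "x \<in> V \<Longrightarrow> G r x y \<Longrightarrow> scale y \<le> level x"
  unfolding level_def using finite_V reach_V by (intro Max_ge) auto

lemma level_ex:
  assumes "x \<in> V"
  shows "\<exists>w\<in>V. G r x w \<and> scale w = level x"
proof -
  have "x \<in> {y \<in> V. G r x y}" using assms near_mono[OF near_refl] by blast
  then have "scale ` {y \<in> V. G r x y} \<noteq> {}" by blast
  then have "level x \<in> scale ` {y \<in> V. G r x y}" unfolding level_def using finite_V by (intro Max_in) auto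
  then show ?thesis by auto
qed

definition base :: real where "base = grid_factor d r * \<epsilon>"
definition side :: "nat \<Rightarrow> real" where "side k = base * lam ^ k"

lemma base_pos: "base > 0"
proof -
  have "grid_factor d r > 0" unfolding grid_factor_def by (simp only: of_nat_0_less_iff) simp
  then show ?thesis unfolding base_def using eps_pos by simp
qed

lemma side_pos: "side k > 0"
  unfolding side_def using base_pos lam_gt1 by simp

lemma side_eq: "side k = grid_factor d r * (\<epsilon> * lam ^ k)"
  by (simp add: side_def base_def)

definition shift :: "'v \<Rightarrow> nat" where
  "shift x = (SOME i. i \<le> d \<and> (\<forall>q. norm (q - pt x) < side (level x) / real (2 * (d + 1)) \<longrightarrow>
     cell (side (level x)) i q = cell (side (level x)) i (pt x)))"

lemma shift: "shift x \<le> d"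
  and shift_padded: "norm (q - pt x) \<le> real (r + 1) * (\<epsilon> * lam ^ level x) \<Longrightarrow>
     cell (side (level x)) (shift x) q = cell (side (level x)) (shift x) (pt x)"
proof -
  have *: "shift x \<le> d \<and> (\<forall>q. norm (q - pt x) < side (level x) / real (2 * (d + 1)) \<longrightarrow>
     cell (side (level x)) (shift x) q = cell (side (level x)) (shift x) (pt x))"
    unfolding shift_def by (rule someI_ex) (rule cell_padded[OF side_pos, of "pt x", folded d_eq])
  then show "shift x \<le> d" by blast
  have "side (level x) / real (2 * (d + 1)) = real (r + 2) * (\<epsilon> * lam ^ level x)"
  proof -
    have "a * b * c / a = b * c" if "a > 0" for a b c :: real using that by simp
    from this[of "real (2 * (d + 1))" "real (r + 2)"] show ?thesis
      unfolding side_eq grid_factor_def of_nat_mult by simp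
  qed
  moreover have "real (r + 1) * (\<epsilon> * lam ^ level x) < real (r + 2) * (\<epsilon> * lam ^ level x)"
    using unit_pos[of "level x"] by (intro mult_strict_right_mono) auto
  ultimately show "norm (q - pt x) \<le> real (r + 1) * (\<epsilon> * lam ^ level x) \<Longrightarrow>
     cell (side (level x)) (shift x) q = cell (side (level x)) (shift x) (pt x)"
    using * by simp
qed

definition annulus :: "'v set" where "annulus = {v \<in> V. a \<le> depth v \<and> depth v \<le> a + l}"
definition part :: "nat \<Rightarrow> 'v set" where "part i = {x \<in> annulus. shift x = i}"
definition below :: "nat \<Rightarrow> 'v \<Rightarrow> 'v set" where
  "below i x = {y \<in> part i. level y \<le> level x \<and>
     cell (side (level x)) i (pt y) = cell (side (level x)) i (pt x)}"

lemma part_V: "x \<in> part i \<Longrightarrow> x \<in> V"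
  by (simp add: part_def annulus_def)

lemma cell_up:
  fixes p q :: 'a
  shows "cell (side j) i p = cell (side j) i q \<Longrightarrow> j \<le> k \<Longrightarrow> cell (side k) i p = cell (side k) i q"
  unfolding side_def
  using cell_nested_power[where p = p and q = q and s = base and i = i and j = j and k = k, folded d_eq, folded lam_eq] base_pos
  by blast

lemma below_self: "x \<in> part i \<Longrightarrow> x \<in> below i x"
  by (simp add: below_def)

lemma below_sub: "below i x \<subseteq> part i"
  by (auto simp: below_def)

lemma below_trans: "y \<in> below i x \<Longrightarrow> below i y \<subseteq> below i x"
proof
  fix z assume y: "y \<in> below i x" and z: "z \<in> below i y"
  then have "cell (side (level x)) i (pt z) = cell (side (level x)) i (pt y)"
    using cell_up[of "level y" i "pt z" "pt y" "level x"] by (simp add: below_def)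
  then show "z \<in> below i x" using y z by (simp add: below_def)
qed

lemma below_laminar:
  "below i x \<subseteq> below i y \<or> below i y \<subseteq> below i x \<or> below i x \<inter> below i y = {}"
proof -
  have *: "below i x \<subseteq> below i y"
    if z: "z \<in> below i x" "z \<in> below i y" and le: "level x \<le> level y" for x y z
  proof -
    have c: "cell (side (level y)) i (pt w) = cell (side (level y)) i (pt y)" if "w \<in> below i x" for w
    proof -
      have "cell (side (level x)) i (pt w) = cell (side (level x)) i (pt z)"
        using that z by (simp add: below_def)
      from cell_up[OF this le] show ?thesis using z by (simp add: below_def)
    qed
    show ?thesis
    proof
      fix w assume w: "w \<in> below i x"
      then show "w \<in> below i y" using c[OF w] le by (auto simp: below_def)
    qed
  qed
  show ?thesis using *[of _ x y] *[of _ y x] by (metis IntE all_not_in_conv nat_le_linear)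
qed

text \<open>The walk stays in the \<open>r\<close>-ball of \<open>x\<close>, where scales are at
  most \<open>level x\<close>. So the representative points differ by at most \<open>r + 1\<close>
  units and share the padded cell of \<open>x\<close>, hence also the larger cell of
  \<open>y\<close>.\<close>

lemma below_comparable_aux:
  assumes x: "x \<in> part i" and y: "y \<in> part i" and xy: "G r x y" and le: "level x \<le> level y"
  shows "x \<in> below i y"
proof -
  have V: "x \<in> V" "y \<in> V" using x y part_V by auto
  obtain w q where w: "w \<in> V" "G r x w" "q \<in> S w"
    "norm (pt x - q) \<le> real r * (\<epsilon> * lam ^ level x)" "w = y \<or> level x < scale w"
    using drift[OF xy V(1) pt_S[OF V(1)], of "level x"] by blast
  have "w = y" using w(5) level_ge[OF V(1) w(2)] by simp
  then have "norm (q - pt y) \<le> diameter (K y)" using diam_K[OF V(2)] w(3) S_sub[OF V(2)] pt_K[OF V(2)] by blast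
  also have "\<dots> \<le> \<epsilon> * lam ^ level x" using scale_le_diam level_ge[OF V(1) xy] by blast
  finally have "norm (pt x - pt y) \<le> real r * (\<epsilon> * lam ^ level x) + \<epsilon> * lam ^ level x"
    using w(4) norm_triangle_ineq[of "pt x - q" "q - pt y"] by simp
  then have "norm (pt y - pt x) \<le> real (r + 1) * (\<epsilon> * lam ^ level x)"
    by (simp add: algebra_simps norm_minus_commute)
  then have "cell (side (level x)) i (pt y) = cell (side (level x)) i (pt x)"
    using shift_padded[of "pt y" x] x by (simp add: part_def)
  from cell_up[OF this le] show ?thesis using x le by (simp add: below_def)
qed

lemma below_comparable:
  assumes "x \<in> part i" "y \<in> part i" "G r x y"
  shows "x \<in> below i y \<or> y \<in> below i x"
  using below_comparable_aux[OF assms] below_comparable_aux[OF assms(2,1) near_sym[OF assms(3)]]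
  by linarith

end

section \<open>Hubs for the border of a cell\<close>

context hollow_annulus begin

lemma d_pos: "d \<ge> 1"
  using d_eq DIM_positive[where 'a = 'a] by simp

text \<open>Either \<open>x\<close> has the level of \<open>c\<close>, or its neighbour outside has
  a larger level, for otherwise that neighbour would share the cell of \<open>c\<close>. Some set
  within distance \<open>2 * r\<close> realises the level, and \<open>drift\<close> finds a large
  one that is also near in space.\<close>

lemma border_escape:
  assumes c: "c \<in> part i" and x: "x \<in> below i c"
    and border: "below i x = below i c \<or> (\<exists>y\<in>part i - below i c. G r x y)"
  shows "\<exists>w q. w \<in> V \<and> G (2 * r) x w \<and> q \<in> S w \<and>
    norm (pt x - q) \<le> real (2 * r) * (\<epsilon> * lam ^ level c) \<and> level c \<le> scale w"
proof -
  have xi: "x \<in> part i" and xV: "x \<in> V" using x below_sub part_V by blast+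
  have "\<exists>u\<in>V. G (2 * r) x u \<and> level c \<le> scale u"
    using border
  proof
    assume "below i x = below i c"
    then have "level c \<le> level x" using below_self[OF c] by (auto simp: below_def)
    moreover obtain u where "u \<in> V" "G r x u" "scale u = level x" using level_ex[OF xV] by blast
    moreover have "G (2 * r) x u" by (rule near_mono[OF calculation(3)]) simp
    ultimately show ?thesis by auto
  next
    assume "\<exists>y\<in>part i - below i c. G r x y"
    then obtain y where y: "y \<in> part i" "y \<notin> below i c" "G r x y" by blast
    have "x \<in> below i y" using below_comparable[OF xi y(1,3)] below_trans[OF x] y(2) by blast
    have "level c < level y"
    proof (rule ccontr)
      assume "\<not> level c < level y"
      then have "cell (side (level c)) i (pt x) = cell (side (level c)) i (pt y)"
        using \<open>x \<in> below i y\<close> cell_up[of "level y" i "pt x" "pt y" "level c"] by (simp add: below_def)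
      then have "y \<in> below i c" using x y(1) \<open>\<not> level c < level y\<close> by (simp add: below_def)
      then show False using y by simp
    qed
    moreover obtain u where u: "u \<in> V" "G r y u" "scale u = level y" using level_ex[OF part_V[OF y(1)]] by blast
    moreover have "G (2 * r) x u" unfolding mult_2 by (rule near_trans[OF y(3) u(2)])
    ultimately show ?thesis by auto
  qed
  then obtain u where u: "u \<in> V" "G (2 * r) x u" "level c \<le> scale u" by blast
  obtain w q where w: "w \<in> V" "G (2 * r) x w" "q \<in> S w"
    "norm (pt x - q) \<le> real (2 * r) * (\<epsilon> * lam ^ level c)" "w = u \<or> level c < scale w"
    using drift[OF u(2) xV pt_S[OF xV]] by blast
  have "level c \<le> scale w" using w(5) u(3) by auto
  then show ?thesis using w by blast
qed

lemma norm_le_coords: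
  fixes x :: 'a
  assumes "\<And>b. b \<in> Basis \<Longrightarrow> \<bar>x \<bullet> b\<bar> \<le> e"
  shows "norm x \<le> real d * e"
proof -
  have "norm x \<le> (\<Sum>b\<in>Basis. \<bar>x \<bullet> b\<bar>)" by (rule norm_le_l1)
  also have "\<dots> \<le> (\<Sum>b\<in>(Basis::'a set). e)" using assms by (rule sum_mono)
  finally show ?thesis by (simp add: d_eq)
qed

text \<open>\<open>2 * r\<close> to a large set, and \<open>(l + 4 * r) + 2\<close> from
  \<open>nested_close\<close>, since the depths of these large sets spread over at most
  \<open>l + 4 * r\<close>.\<close>

definition hub_radius :: nat where "hub_radius = l + 6 * r + 2"

text \<open>The lowest scale has no lower bound on diameters, so records are useless there. Instead,
  by the choice of \<epsilon>, all vertices in such a cell have the same representative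
  point.\<close>

lemma hubs_bottom:
  assumes c: "c \<in> part i" and zero: "level c = 0" and x: "x \<in> below i c"
  shows "G 1 x c"
proof -
  have V: "x \<in> V" "c \<in> V" using x c below_sub part_V by blast+
  have "cell (side 0) i (pt x) = cell (side 0) i (pt c)" using x zero by (simp add: below_def)
  then have "\<bar>(pt x - pt c) \<bullet> b\<bar> \<le> grid_factor d r * \<epsilon>" if "b \<in> Basis" for b
    using cell_diff[OF side_pos[of 0] _ that, of i "pt x" "pt c"] by (simp add: side_eq)
  then have "norm (pt x - pt c) \<le> real d * (grid_factor d r * \<epsilon>)" by (rule norm_le_coords)
  then have "pt x = pt c" using eps_pt[OF V] by (fastforce simp: mult.assoc)
  then have "S x \<inter> S c \<noteq> {}" using pt_S[OF V(1)] pt_S[OF V(2)] by auto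
  then show ?thesis by (rule G_close[OF V])
qed

lemma hubs_exist:
  assumes c: "c \<in> part i"
  shows "\<exists>Z. finite Z \<and> card Z \<le> hub_number d \<alpha> r \<and>
    (\<forall>x\<in>below i c. below i x = below i c \<or> (\<exists>y\<in>part i - below i c. G r x y) \<longrightarrow>
       (\<exists>z\<in>Z. G hub_radius x z))"
proof (cases "level c")
  case 0
  have one: "1 \<le> hub_radius" by (simp add: hub_radius_def)
  have "G hub_radius x c" if "x \<in> below i c" for x
    by (rule near_mono[OF hubs_bottom[OF c 0 that] one])
  moreover have "1 \<le> hub_number d \<alpha> r" by (simp add: hub_number_def)
  ultimately show ?thesis by (intro exI[of _ "{c}"]) auto
next
  case (Suc m)
  define B where "B = {x \<in> below i c. below i x = below i c \<or> (\<exists>y\<in>part i - below i c. G r x y)}"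
  have "\<forall>x\<in>B. \<exists>w q. w \<in> V \<and> G (2 * r) x w \<and> q \<in> S w \<and>
    norm (pt x - q) \<le> real (2 * r) * (\<epsilon> * lam ^ level c) \<and> level c \<le> scale w"
    using border_escape[OF c] by (simp add: B_def)
  then obtain w q where wq: "\<And>x. x \<in> B \<Longrightarrow> w x \<in> V \<and> G (2 * r) x (w x) \<and> q x \<in> S (w x) \<and>
    norm (pt x - q x) \<le> real (2 * r) * (\<epsilon> * lam ^ level c) \<and> level c \<le> scale (w x)"
    by metis
  define U where "U = \<epsilon> * lam ^ level c"
  define \<mu> where "\<mu> = \<epsilon> * lam ^ m"
  have U: "U = lam * \<mu>" by (simp add: U_def \<mu>_def Suc)
  have mu: "\<mu> > 0" "\<mu> \<le> U" using unit_pos unit_mono[of m "level c"] Suc by (simp_all add: U_def \<mu>_def)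
  \<comment> \<open>The mesh size makes \<open>\<alpha> * (real d * \<eta>)\<close> equal to
    \<open>\<mu> / 2\<close>, half the diameter of the contracted copies. The factor
    \<open>lam\<close> is there because the large sets are only known to exceed the previous unit
    \<mu>.\<close>
  define \<eta> where "\<eta> = U / (2 * real d * \<alpha> * lam)"
  have den: "2 * real d * \<alpha> * lam > 0" using d_pos alpha lam_gt1 by simp
  have eta: "\<eta> > 0" using den mu by (simp add: \<eta>_def)
  \<comment> \<open>Contracting towards \<open>q x\<close> to the common diameter \<mu> keeps the
    copy inside the convex set and close to the cell, however large the set is.\<close>
  define t where "t x = \<mu> / diameter (K (w x))" for x
  define cp where "cp x = (\<lambda>z. q x + t x *\<^sub>R (z - q x)) ` K (w x)" for x
  define mesh where "mesh p = (\<lambda>b\<in>Basis. \<lfloor>(p - pt c) \<bullet> b / \<eta>\<rfloor>)" for p :: 'a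
  define ty where "ty x = (mesh ` cp x, S v0 \<subseteq> interior (K (w x)))" for x
  let ?M = "int (mesh_number d \<alpha> r)"
  let ?T = "Pow (PiE (Basis :: 'a set) (\<lambda>_. {-?M..?M})) \<times> (UNIV :: bool set)"
  have qK: "q x \<in> K (w x)" if "x \<in> B" for x using wq[OF that] S_sub by blast
  have diam: "\<mu> < diameter (K (w x))" if "x \<in> B" for x
    using scale_gt_diam[of m "w x"] wq[OF that] Suc by (simp add: \<mu>_def)
  have t: "0 < t x" "t x \<le> 1" "t x * diameter (K (w x)) = \<mu>" if "x \<in> B" for x
    using diam[OF that] mu by (simp_all add: t_def)
  have cp_sub: "p \<in> K (w x)" if x: "x \<in> B" and p: "p \<in> cp x" for x p
  proof -
    obtain z where z: "z \<in> K (w x)" "p = q x + t x *\<^sub>R (z - q x)" using p by (auto simp: cp_def)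
    have "p = (1 - t x) *\<^sub>R q x + t x *\<^sub>R z" using z by (simp add: algebra_simps)
    then show ?thesis using convexD[OF convex_K qK[OF x] z(1), of "1 - t x" "t x"] wq[OF x] t[OF x] by simp
  qed
  have cp_near: "norm (p - q x) \<le> U" if x: "x \<in> B" and p: "p \<in> cp x" for x p
  proof -
    obtain z where z: "z \<in> K (w x)" "p = q x + t x *\<^sub>R (z - q x)" using p by (auto simp: cp_def)
    have "norm (p - q x) = t x * norm (z - q x)" using z t[OF x] by simp
    also have "\<dots> \<le> t x * diameter (K (w x))"
      using diam_K[OF _ z(1) qK[OF x]] wq[OF x] t(1)[OF x] by (intro mult_left_mono) auto
    finally show ?thesis using t(3)[OF x] mu by simp
  qed
  have ty_T: "ty x \<in> ?T" if x: "x \<in> B" for x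
  proof -
    have "mesh p b \<in> {-?M..?M}" if p: "p \<in> cp x" and b: "b \<in> Basis" for p b
    proof -
      let ?Y = "(grid_factor d r + 2 * real r + 1) * (2 * real d * \<alpha> * lam)"
      have "cell (side (level c)) i (pt x) = cell (side (level c)) i (pt c)"
        using x by (simp add: B_def below_def)
      then have "\<bar>(pt x - pt c) \<bullet> b\<bar> \<le> grid_factor d r * U"
        using cell_diff[OF side_pos[of "level c"] _ b] by (fastforce simp: side_eq U_def)
      moreover have "\<bar>(q x - pt x) \<bullet> b\<bar> \<le> 2 * real r * U"
        using Basis_le_norm[OF b, of "q x - pt x"] wq[OF x] by (simp add: U_def norm_minus_commute)
      moreover have "\<bar>(p - q x) \<bullet> b\<bar> \<le> U"
        using Basis_le_norm[OF b, of "p - q x"] cp_near[OF x p] by simp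
      moreover have "(p - pt c) \<bullet> b = (p - q x) \<bullet> b + (q x - pt x) \<bullet> b + (pt x - pt c) \<bullet> b"
        by (simp add: inner_diff_left)
      ultimately have "\<bar>(p - pt c) \<bullet> b\<bar> \<le> U + 2 * real r * U + grid_factor d r * U" by linarith
      also have "\<dots> = (grid_factor d r + 2 * real r + 1) * U" by (simp add: algebra_simps)
      also have "\<dots> = ?Y * \<eta>"
      proof -
        have "g * u = g * e * (u / e)" if "e > 0" for g u e :: real using that by simp
        from this[OF den] show ?thesis by (simp only: \<eta>_def)
      qed
      finally have le: "\<bar>(p - pt c) \<bullet> b / \<eta>\<bar> \<le> ?Y" using eta by (simp add: pos_divide_le_eq)
      have "?Y \<le> real_of_int ?M"
        unfolding mesh_number_def lam_eq by linarith
      then have "- real_of_int ?M \<le> (p - pt c) \<bullet> b / \<eta>" "(p - pt c) \<bullet> b / \<eta> \<le> real_of_int ?M"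
        using le by linarith+
      then have "- ?M \<le> \<lfloor>(p - pt c) \<bullet> b / \<eta>\<rfloor>" "\<lfloor>(p - pt c) \<bullet> b / \<eta>\<rfloor> \<le> ?M"
        by linarith+
      then show ?thesis using b by (simp add: mesh_def)
    qed
    then have "mesh ` cp x \<subseteq> PiE Basis (\<lambda>_. {-?M..?M})" by (auto simp: mesh_def)
    then show ?thesis by (simp add: ty_def)
  qed
  have finT: "finite ?T" by (intro finite_cartesian_product finite_Pow_iff[THEN iffD2] finite_PiE) auto
  have cardT: "card ?T = hub_number d \<alpha> r"
    by (simp add: card_cartesian_product card_Pow card_PiE finite_PiE hub_number_def d_eq nat_add_distrib nat_mult_distrib)
  have close: "G (l + 4 * r + 2) (w x) (w y)" if x: "x \<in> B" and y: "y \<in> B" and eq: "ty x = ty y" for x y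
  proof -
    have V: "w x \<in> V" "w y \<in> V" using wq x y by blast+
    have "K (w x) \<inter> K (w y) \<noteq> {}"
    proof (rule convex_meet[OF convex_K compact_K convex_K compact_K qK[OF x] t(1,2)[OF x]])
      show "w x \<in> V" "w x \<in> V" "w y \<in> V" "w y \<in> V" using V by auto
      show "diameter (K (w x)) \<le> \<alpha> * height (K (w x))" using aspect[OF V(1)] .
      show "0 \<le> \<alpha>" using alpha by simp
      have "\<alpha> * (real d * \<eta>) = \<mu> / 2" using d_pos alpha lam_gt1 by (simp add: \<eta>_def U)
      then show "\<alpha> * (real d * \<eta>) < t x * diameter (K (w x))" using t(3)[OF x] mu(1) by simp
      fix z assume z: "z \<in> K (w x)"
      let ?p = "q x + t x *\<^sub>R (z - q x)"
      have "mesh ?p \<in> mesh ` cp x" using z by (auto simp: cp_def)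
      then have "mesh ?p \<in> mesh ` cp y" using eq by (simp add: ty_def)
      then obtain p' where p': "p' \<in> cp y" "mesh ?p = mesh p'" by blast
      have "norm (?p - p') \<le> real d * \<eta>"
      proof (rule norm_le_coords)
        fix b :: 'a assume b: "b \<in> Basis"
        have "\<lfloor>(?p - pt c) \<bullet> b / \<eta>\<rfloor> = \<lfloor>(p' - pt c) \<bullet> b / \<eta>\<rfloor>"
          using fun_cong[OF p'(2), of b] b by (simp add: mesh_def)
        then have "\<bar>(?p - pt c) \<bullet> b / \<eta> - (p' - pt c) \<bullet> b / \<eta>\<bar> \<le> 1" by linarith
        also have "(?p - pt c) \<bullet> b / \<eta> - (p' - pt c) \<bullet> b / \<eta> = ((?p - p') \<bullet> b) / \<eta>"
          by (simp add: inner_diff_left diff_divide_distrib)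
        finally show "\<bar>(?p - p') \<bullet> b\<bar> \<le> \<eta>" using eta by (simp add: pos_divide_le_eq)
      qed
      then show "\<exists>y'\<in>K (w y). norm (?p - y') \<le> real d * \<eta>" using cp_sub[OF y p'(1)] by blast
    qed
    moreover have "(S v0 \<subseteq> interior (K (w x))) = (S v0 \<subseteq> interior (K (w y)))" using eq by (simp add: ty_def)
    moreover have dep: "depth (w u) \<le> a + l + 2 * r \<and> a \<le> depth (w u) + 2 * r" if u: "u \<in> B" for u
    proof -
      have "u \<in> annulus" using u below_sub by (auto simp: B_def part_def)
      then have "u \<in> V" "a \<le> depth u" "depth u \<le> a + l" by (auto simp: annulus_def)
      moreover have "G (2 * r) u (w u)" "w u \<in> V" using wq[OF u] by auto
      ultimately show ?thesis
        using depth_lipschitz[of u "2 * r" "w u"] depth_lipschitz[of "w u" "2 * r" u] near_sym by fastforce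
    qed
    ultimately show ?thesis
      by (intro nested_close[OF V]) (use dep[OF x] dep[OF y] in auto)
  qed
  define Z where "Z = (\<lambda>\<theta>. w (inv_into B ty \<theta>)) ` (ty ` B)"
  have tyB: "ty ` B \<subseteq> ?T" using ty_T by blast
  have fin: "finite (ty ` B)" using finite_subset[OF tyB finT] .
  have "card Z \<le> card (ty ` B)" unfolding Z_def by (rule card_image_le[OF fin])
  also have "\<dots> \<le> hub_number d \<alpha> r" using card_mono[OF finT tyB] cardT by simp
  finally have "card Z \<le> hub_number d \<alpha> r" .
  moreover have "\<exists>z\<in>Z. G hub_radius x z" if x: "x \<in> B" for x
  proof -
    let ?y = "inv_into B ty (ty x)"
    have y: "?y \<in> B" "ty ?y = ty x" using inv_into_into[of "ty x" ty B] f_inv_into_f[of "ty x" ty B] x by auto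
    have "G (2 * r + (l + 4 * r + 2)) x (w ?y)"
      using near_trans[OF _ close[OF x y(1) y(2)[symmetric]]] wq[OF x] by blast
    then have "G hub_radius x (w ?y)" by (rule near_mono) (simp add: hub_radius_def)
    moreover have "w ?y \<in> Z" using x by (auto simp: Z_def)
    ultimately show ?thesis by blast
  qed
  ultimately show ?thesis using fin by (intro exI[of _ Z]) (auto simp: B_def Z_def)
qed

definition part_bound :: nat where
  "part_bound = tree_bound (hub_number d \<alpha> r) (hub_number d \<alpha> r) 1 1 * max hub_radius r"

lemma part_two_colouring:
  "\<exists>C. cbd r part_bound (part i \<inter> C) \<and> cbd r part_bound (part i - C)"
proof (cases "part i = {}")
  case True
  have "cbd r part_bound {}" unfolding cbd_def using conn_in by blast
  then show ?thesis using True by simp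
next
  case False
  \<comment> \<open>The hubs are chosen from the set alone, since several vertices may own the same
    set.\<close>
  define Z where "Z L = (SOME Z. finite Z \<and> card Z \<le> hub_number d \<alpha> r \<and>
    (\<forall>x\<in>L. below i x = L \<or> (\<exists>y\<in>part i - L. G r x y) \<longrightarrow> (\<exists>z\<in>Z. G hub_radius x z)))" for L
  have Z: "finite (Z (below i c)) \<and> card (Z (below i c)) \<le> hub_number d \<alpha> r \<and>
    (\<forall>x\<in>below i c. below i x = below i c \<or> (\<exists>y\<in>part i - below i c. G r x y) \<longrightarrow>
       (\<exists>z\<in>Z (below i c). G hub_radius x z))" if "c \<in> part i" for c
    unfolding Z_def by (rule someI_ex[OF hubs_exist[OF that]])
  interpret hub: hub_space G "part i" "below i" Z r hub_radius "hub_number d \<alpha> r"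
  proof unfold_locales
    show "finite (part i)" using finite_V by (simp add: part_def annulus_def)
    show "part i \<noteq> {}" using False .
    show "x \<in> below i x" if "x \<in> part i" for x using below_self[OF that] .
    show "below i x \<subseteq> part i" for x by (rule below_sub)
    show "below i y \<subseteq> below i x" if "y \<in> below i x" for x y by (rule below_trans[OF that])
    show "below i x \<subseteq> below i y \<or> below i y \<subseteq> below i x \<or> below i x \<inter> below i y = {}" for x y
      by (rule below_laminar)
    show "x \<in> below i y \<or> y \<in> below i x" if "x \<in> part i" "y \<in> part i" "G r x y" for x y
      by (rule below_comparable[OF that])
    show "finite (Z (below i c))" "card (Z (below i c)) \<le> hub_number d \<alpha> r" if "c \<in> part i" for c
      using Z[OF that] by auto
    show "\<exists>z\<in>Z (below i c). G hub_radius x z"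
      if "c \<in> part i" "x \<in> below i c" "below i x = below i c \<or> (\<exists>y\<in>part i - below i c. G r x y)" for c x
      using Z[OF that(1)] that(2,3) by blast
  qed
  show ?thesis using hub.hub_two_colouring by (simp add: part_bound_def)
qed

theorem annulus_colouring:
  "\<exists>col. (\<forall>x\<in>annulus. col x < 2 * (d + 1)) \<and> (\<forall>c. cbd r part_bound {x \<in> annulus. col x = c})"
proof -
  obtain C where C: "\<And>i. cbd r part_bound (part i \<inter> C i) \<and> cbd r part_bound (part i - C i)"
    using part_two_colouring by metis
  define col where "col x = 2 * shift x + (if x \<in> C (shift x) then 0 else 1)" for x
  have "col x < 2 * (d + 1)" for x using shift[of x] by (simp add: col_def)
  moreover have "cbd r part_bound {x \<in> annulus. col x = c}" for c
  proof (cases "even c")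
    case True
    have "{x \<in> annulus. col x = c} \<subseteq> part (c div 2) \<inter> C (c div 2)"
      using True by (auto simp: col_def part_def split: if_splits)
    then show ?thesis using cbd_mono[OF conjunct1[OF C]] by blast
  next
    case False
    have "{x \<in> annulus. col x = c} \<subseteq> part (c div 2) - C (c div 2)"
      using False by (auto simp: col_def part_def split: if_splits)
    then show ?thesis using cbd_mono[OF conjunct2[OF C]] by blast
  qed
  ultimately show ?thesis by blast
qed

end

section \<open>Adding one colour over the layers of a graph\<close>

context near_space begin

lemma conn_invariant:
  assumes "conn r S x y" "\<And>u v. u \<in> S \<Longrightarrow> v \<in> S \<Longrightarrow> W r u v \<Longrightarrow> f u = f v"
  shows "f x = f y"
  using assms(1)
proof (induction rule: conn.induct)
  case (conn_step x y z)
  then show ?case using assms(2)[of y z] conn_in[OF conn_step(1)] by simp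
qed simp

text \<open>Kolmogorov's trick. Classes are thickened by \<open>r\<close>, so a step of length
  \<open>r\<close> becomes one of length \<open>3 * r\<close> in the class. Points reached by no
  foreign thickening form the extra set, in which steps of length \<open>r\<close> preserve the
  colour.\<close>

lemma double_cover:
  assumes col: "\<And>x. x \<in> X \<Longrightarrow> col x < m" and bd: "\<And>c. cbd (3 * r) D {x \<in> X. col x = c}"
  shows "\<exists>P :: nat \<Rightarrow> 'a set. (\<forall>c. P c \<subseteq> X \<and> cbd r (D + 2 * r) (P c)) \<and>
    (\<forall>x\<in>X. \<exists>c c'. c \<noteq> c' \<and> c \<le> m \<and> c' \<le> m \<and> x \<in> P c \<and> x \<in> P c')"
proof -
  define U where "U c = {x \<in> X. col x = c}" for c
  define N where "N c = {x \<in> X. \<exists>u\<in>U c. W r x u}" for c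
  define P where "P c = (if c < m then N c else {x \<in> X. \<forall>c'<m. c' \<noteq> col x \<longrightarrow> x \<notin> N c'})" for c
  have N: "cbd r (D + 2 * r) (N c)" for c
    unfolding cbd_def
  proof (intro allI impI)
    fix x y assume xy: "conn r (N c) x y"
    have "\<exists>v\<in>U c. W r y v \<and> conn (3 * r) (U c) u v" if "u \<in> U c" "W r x u" for u
      using xy that
    proof (induction rule: conn.induct)
      case (conn_refl x)
      then show ?case using conn.conn_refl by blast
    next
      case (conn_step x y z)
      obtain v where v: "v \<in> U c" "W r y v" "conn (3 * r) (U c) u v"
        using conn_step.IH[OF conn_step.prems] by blast
      obtain v' where v': "v' \<in> U c" "W r z v'" using conn_step by (auto simp: N_def)
      have "W (r + r + r) v v'"
        using near_trans[OF near_trans[OF near_sym[OF v(2)] conn_step(3)] v'(2)] .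
      then have "W (3 * r) v v'" by (rule near_mono) simp
      then show ?case using v v' conn.conn_step by blast
    qed
    moreover obtain u where u: "u \<in> U c" "W r x u" using conn_in[OF xy] by (auto simp: N_def)
    ultimately obtain v where v: "W r y v" "conn (3 * r) (U c) u v" by blast
    have "W D u v" using bd[of c] v(2) by (simp add: cbd_def U_def)
    then have "W (r + D + r) x y" using near_trans[OF near_trans[OF u(2)] near_sym[OF v(1)]] by blast
    then show "W (D + 2 * r) x y" by (rule near_mono) simp
  qed
  have last: "cbd r (D + 2 * r) {x \<in> X. \<forall>c'<m. c' \<noteq> col x \<longrightarrow> x \<notin> N c'}"
  proof (rule cbd_split[where f = col])
    fix x y assume *: "x \<in> {x \<in> X. \<forall>c'<m. c' \<noteq> col x \<longrightarrow> x \<notin> N c'}"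
      "y \<in> {x \<in> X. \<forall>c'<m. c' \<noteq> col x \<longrightarrow> x \<notin> N c'}" "W r x y"
    then have "x \<in> N (col y)" by (auto simp: N_def U_def)
    then show "col x = col y" using * col by force
  next
    fix x
    show "cbd r (D + 2 * r) {y \<in> {x \<in> X. \<forall>c'<m. c' \<noteq> col x \<longrightarrow> x \<notin> N c'}. col y = col x}"
      by (rule cbd_mono[OF bd[of "col x"]]) auto
  qed
  have "\<exists>c c'. c \<noteq> c' \<and> c \<le> m \<and> c' \<le> m \<and> x \<in> P c \<and> x \<in> P c'" if x: "x \<in> X" for x
  proof -
    have c: "col x < m" "x \<in> P (col x)"
      using col[OF x] x near_mono[OF near_refl] by (auto simp: P_def N_def U_def)
    show ?thesis
    proof (cases "\<exists>c'<m. c' \<noteq> col x \<and> x \<in> N c'")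
      case True
      then show ?thesis using c by (metis P_def less_imp_le)
    next
      case False
      then have "x \<in> P m" using x by (auto simp: P_def)
      then show ?thesis using c by (intro exI[of _ "col x"] exI[of _ m]) auto
    qed
  qed
  moreover have "P c \<subseteq> X \<and> cbd r (D + 2 * r) (P c)" for c
    using N last by (auto simp: P_def N_def)
  ultimately show ?thesis by blast
qed

end

definition layered_bound :: "(nat \<Rightarrow> nat \<Rightarrow> nat) \<Rightarrow> nat \<Rightarrow> nat \<Rightarrow> nat" where
  "layered_bound B m r = (let D = B (3 * r) ((2 * m + 4) * r) + 2 * r
     in B (D + 2 * r) (2 * r) + 2 * (D + r))"

text \<open>Blocks of layers of two kinds alternate. In a block of the first kind every point has two
  colours, so each colour can give up a band of layers, at a different height for each colour.
  This way a component meets at most one block of the second kind.\<close>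

theorem (in near_space) layered_cover:
  fixes f :: "'a \<Rightarrow> nat" and B :: "nat \<Rightarrow> nat \<Rightarrow> nat"
  assumes lip: "\<And>x y. x \<in> V \<Longrightarrow> y \<in> V \<Longrightarrow> W r x y \<Longrightarrow> f y \<le> f x + r" and r: "r > 0"
    and layers: "\<And>r a l. \<exists>col. (\<forall>x\<in>{v \<in> V. a \<le> f v \<and> f v \<le> a + l}. col x < m) \<and>
      (\<forall>c. cbd r (B r l) {x \<in> {v \<in> V. a \<le> f v \<and> f v \<le> a + l}. col x = c})"
  shows "\<exists>T :: nat \<Rightarrow> 'a set. V = (\<Union>c\<le>m. T c) \<and> (\<forall>c\<le>m. cbd r (layered_bound B m r) (T c))"
proof -
  \<comment> \<open>Room for \<open>m + 1\<close> bands of height \<open>r\<close> at distance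
    \<open>r\<close>, and for a margin that keeps points below a band away from the upper end of the
    block.\<close>
  define Le where "Le = (2 * m + 4) * r"
  define P where "P = Le + 2 * r"
  define D2 where "D2 = B (3 * r) Le + 2 * r"
  define rr where "rr = D2 + 2 * r"
  define D3 where "D3 = B rr (2 * r)"
  have bound: "layered_bound B m r = D3 + 2 * (D2 + r)"
    by (simp add: layered_bound_def Let_def D3_def rr_def D2_def Le_def)
  let ?ann = "\<lambda>a l. {v \<in> V. a \<le> f v \<and> f v \<le> a + l}"
  have exQ: "\<exists>Q :: nat \<Rightarrow> 'a set. (\<forall>c. Q c \<subseteq> ?ann (b * P) Le \<and> cbd r D2 (Q c)) \<and>
    (\<forall>x\<in>?ann (b * P) Le. \<exists>c c'. c \<noteq> c' \<and> c \<le> m \<and> c' \<le> m \<and> x \<in> Q c \<and> x \<in> Q c')" for b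
  proof -
    obtain col where col: "\<And>x. x \<in> ?ann (b * P) Le \<Longrightarrow> col x < m"
      "\<And>c. cbd (3 * r) (B (3 * r) Le) {x \<in> ?ann (b * P) Le. col x = c}"
      using layers[of "b * P" Le "3 * r"] by blast
    show ?thesis unfolding D2_def by (rule double_cover[OF col])
  qed
  have "\<exists>Q :: nat \<Rightarrow> nat \<Rightarrow> 'a set. \<forall>b. (\<forall>c. Q b c \<subseteq> ?ann (b * P) Le \<and> cbd r D2 (Q b c)) \<and>
    (\<forall>x\<in>?ann (b * P) Le. \<exists>c c'. c \<noteq> c' \<and> c \<le> m \<and> c' \<le> m \<and> x \<in> Q b c \<and> x \<in> Q b c')"
    by (intro choice allI exQ)
  then obtain Q :: "nat \<Rightarrow> nat \<Rightarrow> 'a set" where Q: "\<forall>b. (\<forall>c. Q b c \<subseteq> ?ann (b * P) Le \<and> cbd r D2 (Q b c)) \<and>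
    (\<forall>x\<in>?ann (b * P) Le. \<exists>c c'. c \<noteq> c' \<and> c \<le> m \<and> c' \<le> m \<and> x \<in> Q b c \<and> x \<in> Q b c')"
    by (rule exE)
  have Q_bd: "cbd r D2 (Q b c)" for b c using Q by blast
  have Q_two: "\<exists>c c'. c \<noteq> c' \<and> c \<le> m \<and> c' \<le> m \<and> x \<in> Q b c \<and> x \<in> Q b c'" if "x \<in> ?ann (b * P) Le" for x b
    using Q[rule_format, of b, THEN conjunct2, rule_format, OF that] .
  have "\<exists>col. \<forall>b. (\<forall>x\<in>?ann (b * P + Le) (2 * r). col b x < m) \<and>
      (\<forall>c. cbd rr D3 {x \<in> ?ann (b * P + Le) (2 * r). col b x = c})"
    unfolding D3_def by (intro choice allI layers)
  then obtain col where col: "\<forall>b. (\<forall>x\<in>?ann (b * P + Le) (2 * r). col b x < m) \<and>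
      (\<forall>c. cbd rr D3 {x \<in> ?ann (b * P + Le) (2 * r). col b x = c})"
    by (rule exE)
  have col_bd: "cbd rr D3 {x \<in> ?ann (b * P + Le) (2 * r). col b x = c}" for b c using col by blast
  have col_lt: "col b x < m" if "x \<in> ?ann (b * P + Le) (2 * r)" for x b
    using col[rule_format, of b, THEN conjunct1, rule_format, OF that] .
  define ix where "ix x = f x div P" for x
  define res where "res x = f x mod P" for x
  have Ppos: "P > 0" using r by (simp add: P_def)
  have f: "f x = ix x * P + res x" and res: "res x < P" for x
    using Ppos by (simp_all add: ix_def res_def)
  define cut where "cut c x \<longleftrightarrow> (2 * c + 1) * r \<le> res x \<and> res x < (2 * c + 2) * r" for c x
  define A where "A c = {x \<in> V. \<not> res x < Le \<and> col (ix x) x = c}" for c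
  define E where "E c = {x \<in> V. res x < Le \<and> x \<in> Q (ix x) c \<and> \<not> cut c x}" for c
  have ix_le: "ix x * P + P \<le> ix y * P" if "ix x < ix y" for x y
  proof -
    have "(ix x + 1) * P \<le> ix y * P" using that by (intro mult_le_mono1) simp
    then show ?thesis by (simp add: algebra_simps)
  qed
  have Le_big: "(2 * c + 1) * r + 3 * r \<le> Le" if "c \<le> m" for c
  proof -
    have "(2 * c + 4) * r \<le> (2 * m + 4) * r" using that by (intro mult_le_mono1) simp
    then show ?thesis by (simp add: Le_def algebra_simps)
  qed
  have band: "(2 * c + 2) * r = (2 * c + 1) * r + r" for c by (simp add: algebra_simps)
  have main: "cbd r (layered_bound B m r) (A c \<union> E c)" if c: "c \<le> m" for c
  proof -
    define low where "low x \<longleftrightarrow> res x < (2 * c + 1) * r" for x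
    have AV: "x \<in> V \<and> Le \<le> res x" if "x \<in> A c" for x using that by (simp add: A_def)
    have EV: "x \<in> V \<and> res x < Le" if "x \<in> E c" for x using that by (simp add: E_def)
    have high: "(2 * c + 1) * r + r \<le> res x" if "x \<in> E c" "\<not> low x" for x
      using that band[of c] by (simp add: E_def cut_def low_def)
    have key: "(ix x, low x) = (ix y, low y)" if xy: "x \<in> E c" "y \<in> E c" "W r x y" for x y
    proof -
      have ne: "\<not> ix u < ix v" if uv: "u \<in> E c" "v \<in> E c" "W r u v" for u v
      proof
        assume "ix u < ix v"
        then have "ix u * P + P \<le> ix v * P" by (rule ix_le)
        moreover have "f v \<le> f u + r" using lip EV uv by blast
        moreover have "res u < Le" using EV uv by blast
        ultimately show False using f[of u] f[of v] r by (simp add: P_def)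
      qed
      have ix: "ix x = ix y" using ne[OF xy] ne[OF xy(2,1) near_sym[OF xy(3)]] by simp
      have nl: "\<not> (low u \<and> \<not> low v)" if uv: "u \<in> E c" "v \<in> E c" "W r u v" "ix u = ix v" for u v
      proof
        assume "low u \<and> \<not> low v"
        then have "res u < (2 * c + 1) * r" "(2 * c + 1) * r + r \<le> res v"
          using high[OF uv(2)] by (auto simp: low_def)
        moreover have "f v \<le> f u + r" using lip EV uv by blast
        ultimately show False using f[of u] f[of v] uv(4) by simp
      qed
      show ?thesis using ix nl[OF xy ix] nl[OF xy(2,1) near_sym[OF xy(3)] ix[symmetric]] by auto
    qed
    have Ebd: "cbd r D2 (E c)"
    proof (rule cbd_split[where f = ix])
      show "ix x = ix y" if "x \<in> E c" "y \<in> E c" "W r x y" for x y using key[OF that] by simp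
      fix x
      show "cbd r D2 {y \<in> E c. ix y = ix x}" by (rule cbd_mono[OF Q_bd]) (auto simp: E_def)
    qed
    define O' where "O' b = {x \<in> A c. ix x = b}" for b
    have Obd: "cbd rr D3 (O' b)" for b
    proof -
      have "O' b \<subseteq> {x \<in> ?ann (b * P + Le) (2 * r). col b x = c}"
      proof
        fix x assume "x \<in> O' b"
        then have x: "x \<in> V" "Le \<le> res x" "col b x = c" "ix x = b" by (auto simp: O'_def A_def)
        then show "x \<in> {x \<in> ?ann (b * P + Le) (2 * r). col b x = c}"
          using f[of x] res[of x] by (simp add: P_def)
      qed
      then show ?thesis by (rule cbd_mono[OF col_bd]) auto
    qed
    have "cbd r (D3 + 2 * (D2 + r)) (A c \<union> E c)"
    proof (rule cbd_absorb[OF Ebd, where Q = "\<lambda>u v. conn rr (O' (ix u)) u v"])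
      show "W D3 u v" if "conn rr (O' (ix u)) u v" for u v using Obd that by (simp add: cbd_def)
      show "conn rr (O' (ix u)) u u" if "u \<in> A c" for u by (rule conn_refl) (simp add: O'_def that)
      show "conn rr (O' (ix u)) u w" if uv: "conn rr (O' (ix u)) u v" and vw: "conn rr (O' (ix v)) v w" for u v w
      proof -
        have "ix v = ix u" using conn_in[OF uv] by (simp add: O'_def)
        then show ?thesis using conn_trans[OF vw] uv by simp
      qed
      have ne: "\<not> ix u < ix v" if uv: "u \<in> A c" "v \<in> A c" "W r u v" for u v
      proof
        assume "ix u < ix v"
        then have "ix u * P + P \<le> ix v * P" by (rule ix_le)
        moreover have "f v \<le> f u + r" using lip AV uv by blast
        moreover have "Le \<le> res v" using AV uv by blast
        moreover have "r < Le" using Le_big[OF c] r by linarith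
        ultimately show False using f[of u] f[of v] res[of u] by simp
      qed
      show "conn rr (O' (ix u)) u v" if uv: "u \<in> A c" "v \<in> A c" "W r u v" for u v
      proof -
        have "ix u = ix v" using ne[OF uv] ne[OF uv(2,1) near_sym[OF uv(3)]] by simp
        moreover have "W rr u v" using uv(3) by (rule near_mono) (simp add: rr_def)
        ultimately show ?thesis using uv by (intro conn_edge) (auto simp: O'_def)
      qed
      \<comment> \<open>Above its band, a component in a block touches only the block of the second
        kind after it; below the band, only the one before it. In the latter case
        \<open>ix b\<close> is positive, so the truncated difference is exact.\<close>
      have side: "ix u = (if low b then ix b - 1 else ix b)" if ub: "u \<in> A c" "b \<in> E c" "W r u b" for u b
      proof -
        have fl: "f b \<le> f u + r" "f u \<le> f b + r" using lip AV EV ub near_sym by blast+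
        have Le: "Le \<le> res u" "res u < P" "res b < Le" using AV EV ub res by blast+
        show ?thesis
        proof (cases "low b")
          case True
          have "res b < (2 * c + 1) * r" using True by (simp add: low_def)
          then have gap: "res b + 3 * r < res u" using Le_big[OF c] Le by linarith
          have "\<not> ix b \<le> ix u"
          proof
            assume "ix b \<le> ix u"
            then have "ix b * P \<le> ix u * P" by (rule mult_le_mono1)
            then show False using f[of u] f[of b] fl gap r by linarith
          qed
          moreover have "\<not> ix u + 1 < ix b"
          proof
            assume "ix u + 1 < ix b"
            then have "(ix u + 2) * P \<le> ix b * P" by (intro mult_le_mono1) simp
            then have "ix u * P + P + P \<le> ix b * P" by (simp add: algebra_simps)
            then show False using f[of u] f[of b] fl Le r unfolding P_def by linarith
          qed
          ultimately show ?thesis using True by simp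
        next
          case False
          have hi: "r < res b" using high[OF ub(2) False] r by (simp add: algebra_simps)
          have "\<not> ix u < ix b"
          proof
            assume "ix u < ix b"
            from ix_le[OF this] show False using f[of u] f[of b] fl Le hi by linarith
          qed
          moreover have "\<not> ix b < ix u"
          proof
            assume "ix b < ix u"
            from ix_le[OF this] show False using f[of u] f[of b] fl Le r unfolding P_def by linarith
          qed
          ultimately show ?thesis using False by simp
        qed
      qed
      show "conn rr (O' (ix u)) u v"
        if uv: "u \<in> A c" "v \<in> A c" "W r u b" "conn r (E c) b b'" "W r b' v" for u v b b'
      proof -
        have bE: "b \<in> E c" "b' \<in> E c" using conn_in[OF uv(4)] by auto
        have "(ix b, low b) = (ix b', low b')" using conn_invariant[OF uv(4), of "\<lambda>x. (ix x, low x)"] key by blast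
        then have ix: "ix u = ix v" using side[OF uv(1) bE(1) uv(3)] side[OF uv(2) bE(2) near_sym[OF uv(5)]] by simp
        have "W D2 b b'" using Ebd uv(4) by (simp add: cbd_def)
        then have "W (r + D2 + r) u v" using near_trans[OF near_trans[OF uv(3)] uv(5)] by blast
        then have "W rr u v" by (rule near_mono) (simp add: rr_def)
        then show ?thesis using uv ix by (intro conn_edge) (auto simp: O'_def)
      qed
    qed
    then show ?thesis by (simp add: bound)
  qed
  have "x \<in> (\<Union>c\<le>m. A c \<union> E c)" if x: "x \<in> V" for x
  proof (cases "res x < Le")
    case True
    then have "x \<in> ?ann (ix x * P) Le" using f[of x] x by simp
    then obtain c c' where c: "c \<noteq> c'" "c \<le> m" "c' \<le> m" "x \<in> Q (ix x) c" "x \<in> Q (ix x) c'"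
      using Q_two by blast
    \<comment> \<open>Bands of different colours are disjoint, so \<open>x\<close> keeps at least
      one of its two colours.\<close>
    have disj: "\<not> (cut i x \<and> cut j x)" if "i < j" for i j
    proof -
      have "(2 * i + 2) * r \<le> (2 * j + 1) * r" using that by (intro mult_le_mono1) simp
      then show ?thesis by (auto simp: cut_def)
    qed
    have "\<not> cut c x \<or> \<not> cut c' x" using disj[of c c'] disj[of c' c] c(1) by (cases "c < c'") auto
    then show ?thesis using c True x by (auto simp: E_def)
  next
    case False
    then have "x \<in> ?ann (ix x * P + Le) (2 * r)" using f[of x] res[of x] x by (simp add: P_def)
    then have "col (ix x) x < m" by (rule col_lt)
    then show ?thesis using False x by (auto simp: A_def intro!: bexI[of _ "col (ix x) x"])
  qed
  then have "V = (\<Union>c\<le>m. A c \<union> E c)" by (auto simp: A_def E_def)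
  then show ?thesis using main by (intro exI[of _ "\<lambda>c. A c \<union> E c"]) blast
qed

section \<open>The class of hollow convex sets\<close>

definition annulus_bound :: "nat \<Rightarrow> real \<Rightarrow> nat \<Rightarrow> nat \<Rightarrow> nat" where
  "annulus_bound d \<alpha> r l =
     tree_bound (hub_number d \<alpha> r) (hub_number d \<alpha> r) 1 1 * max (l + 6 * r + 2) r"

lemma (in hollow_system) layers_colouring:
  "\<exists>col. (\<forall>x\<in>{v \<in> V. a \<le> depth v \<and> depth v \<le> a + l}. col x < 2 * (DIM('a) + 1)) \<and>
     (\<forall>c. cbd r (annulus_bound DIM('a) \<alpha> r l) {x \<in> {v \<in> V. a \<le> depth v \<and> depth v \<le> a + l}. col x = c})"
proof -
  let ?C = "real DIM('a) * grid_factor DIM('a) r"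
  have "grid_factor DIM('a) r > 0" unfolding grid_factor_def by (simp only: of_nat_0_less_iff) simp
  then have C: "?C > 0" by simp
  have "finite ((\<lambda>(u, v). norm (pt u - pt v) / ?C) ` (V \<times> V))" using finite_V by simp
  \<comment> \<open>\<epsilon> depends on the given finite system, but no bound mentions it, so the
    control function remains uniform.\<close>
  then obtain \<epsilon> where \<epsilon>: "\<epsilon> > 0" "\<forall>x\<in>(\<lambda>(u, v). norm (pt u - pt v) / ?C) ` (V \<times> V). 0 < x \<longrightarrow> \<epsilon> < x"
    using finite_pos_lower_bound by blast
  have sep: "?C * \<epsilon> < norm (pt u - pt v)" if "u \<in> V" "v \<in> V" "pt u \<noteq> pt v" for u v
  proof -
    have "0 < norm (pt u - pt v) / ?C" using that C by simp
    then have "\<epsilon> < norm (pt u - pt v) / ?C" using \<epsilon>(2) that by force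
    then show ?thesis using C by (simp add: pos_less_divide_eq mult.commute)
  qed
  interpret hollow_annulus V K S \<alpha> v0 "DIM('a)" "real (DIM('a) + 2)" r l a \<epsilon>
    by unfold_locales (use \<epsilon>(1) sep in auto)
  show ?thesis
    using annulus_colouring unfolding annulus_def annulus_bound_def part_bound_def hub_radius_def .
qed

lemma (in hollow_system) hollow_cover:
  assumes "r > 0"
  shows "\<exists>T :: nat \<Rightarrow> 'v set. V = (\<Union>c\<le>2 * DIM('a) + 2. T c) \<and>
    (\<forall>c\<le>2 * DIM('a) + 2. cbd r (layered_bound (annulus_bound DIM('a) \<alpha>) (2 * DIM('a) + 2) r) (T c))"
  by (rule layered_cover[where f = depth])
    (use assms layers_colouring depth_lipschitz in \<open>simp_all add: algebra_simps\<close>)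

section \<open>From walks and components to the metric and the covers of the statement\<close>

lemma walk_step:
  assumes "is_walk V E u v n" "w \<in> V" "E v w"
  shows "is_walk V E u w (Suc n)"
proof -
  obtain p where p: "p 0 = u" "p n = v" "\<forall>i\<le>n. p i \<in> V" "\<forall>i<n. E (p i) (p (Suc i))"
    using assms(1) by (auto simp: is_walk_def)
  show ?thesis unfolding is_walk_def
    by (rule exI[of _ "p(Suc n := w)"]) (use p assms(2,3) in \<open>auto simp: less_Suc_eq le_Suc_eq\<close>)
qed

lemma walk_butlast:
  assumes "is_walk V E u w (Suc n)"
  shows "\<exists>v\<in>V. is_walk V E u v n \<and> E v w \<and> w \<in> V"
  using assms unfolding is_walk_def by (metis le_SucI lessI less_SucI order_refl)

lemma gdist_reach:
  assumes E: "\<And>u v. u \<in> V \<Longrightarrow> v \<in> V \<Longrightarrow> E u v \<longleftrightarrow> u \<noteq> v \<and> S u \<inter> S v \<noteq> {}"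
    and conn: "graph_connected V E" and uv: "u \<in> V" "v \<in> V"
  shows "gdist V E u v \<le> real k \<longleftrightarrow> reach (meets V S) k u v"
proof -
  have walk_reach: "reach (meets V S) n u w" if "is_walk V E u w n" for n w
    using that
  proof (induction n arbitrary: w)
    case 0
    then show ?case by (auto simp: is_walk_def)
  next
    case (Suc n)
    obtain z where z: "z \<in> V" "is_walk V E u z n" "E z w" "w \<in> V" using walk_butlast[OF Suc.prems] by blast
    then have "(z, w) \<in> meets V S" using E by (simp add: meets_def)
    then show ?case using Suc.IH[OF z(2)] by auto
  qed
  have reach_walk: "\<exists>m\<le>n. is_walk V E u w m" if "reach (meets V S) n u w" for n w
    using that
  proof (induction n arbitrary: w)
    case 0
    then show ?case using uv by (auto simp: is_walk_def)
  next
    case (Suc n)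
    then obtain z where z: "reach (meets V S) n u z" "z = w \<or> (z, w) \<in> meets V S" by auto
    obtain m where m: "m \<le> n" "is_walk V E u z m" using Suc.IH[OF z(1)] by blast
    show ?case
    proof (cases "z = w")
      case True
      then show ?thesis using m le_SucI by blast
    next
      case False
      then have "z \<in> V" "w \<in> V" "E z w" using z(2) E by (auto simp: meets_def)
      then show ?thesis using walk_step[OF m(2)] m(1) by (intro exI[of _ "Suc m"]) auto
    qed
  qed
  let ?d = "LEAST n. is_walk V E u v n"
  have ex: "\<exists>n. is_walk V E u v n" using conn uv by (simp add: graph_connected_def)
  show ?thesis
  proof
    assume "gdist V E u v \<le> real k"
    then have "?d \<le> k" by (simp add: gdist_def)
    moreover have "reach (meets V S) ?d u v" using walk_reach LeastI_ex[OF ex] by blast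
    ultimately show "reach (meets V S) k u v" by (rule reach_mono[rotated])
  next
    assume "reach (meets V S) k u v"
    then obtain m where "m \<le> k" "is_walk V E u v m" using reach_walk by blast
    then have "?d \<le> k" using Least_le order_trans by blast
    then show "gdist V E u v \<le> real k" by (simp add: gdist_def)
  qed
qed

lemma frontier_diff_interior:
  fixes K :: "'a::euclidean_space set"
  assumes "compact K" "R \<subseteq> interior K"
  shows "frontier K \<subseteq> K - R"
  using assms frontier_subset_closed[OF compact_imp_closed] by (auto simp: frontier_def)

text \<open>Graphs with at most one vertex are treated apart because the set of a lone vertex may be
  empty. With a second vertex, connectedness provides an edge and excludes this.\<close>

lemma finite_cover_of_singleton:
  assumes "V \<subseteq> {v}" "b \<ge> 0"
  shows "\<exists>\<U> :: nat \<Rightarrow> nat set set. V = (\<Union>i\<le>n. \<Union>(\<U> i)) \<and>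
    (\<forall>i\<le>n. r_disjoint V E r (\<U> i) \<and> D_bounded V E b (\<U> i))"
proof (intro exI[of _ "\<lambda>_. {V}"] conjI allI impI)
  show "D_bounded V E b {V}"
    unfolding D_bounded_def
  proof (intro ballI)
    fix U x y assume "U \<in> {V}" "x \<in> U" "y \<in> U"
    then have "x = v" "y = v" "v \<in> V" using assms by auto
    then have "is_walk V E x y 0" by (auto simp: is_walk_def)
    then have "(LEAST n. is_walk V E x y n) = 0" by (rule Least_eq_0)
    then show "gdist V E x y \<le> b" using assms by (simp add: gdist_def)
  qed
qed (auto simp: r_disjoint_def)

lemma class_cover:
  fixes r :: real
  assumes C: "in_class_C TYPE('a::euclidean_space) \<alpha> V E" and \<alpha>: "\<alpha> \<ge> 1" and r: "r > 0"
    and b: "b = real (layered_bound (annulus_bound DIM('a) \<alpha>) (2 * DIM('a) + 2) (nat \<lceil>r\<rceil>)) + 1"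
  shows "\<exists>\<U> :: nat \<Rightarrow> nat set set. V = (\<Union>i\<le>2 * DIM('a) + 2. \<Union>(\<U> i)) \<and>
    (\<forall>i\<le>2 * DIM('a) + 2. r_disjoint V E r (\<U> i) \<and> D_bounded V E b (\<U> i))"
proof -
  obtain S K R :: "nat \<Rightarrow> 'a set" where fin: "finite V" and conn: "graph_connected V E"
    and sys': "\<forall>v\<in>V. compact (K v) \<and> convex (K v) \<and> aspect_ratio_le (K v) \<alpha> \<and>
               R v \<subseteq> interior (K v) \<and> S v = K v - R v \<and> path_connected (S v)"
    and E': "\<forall>u\<in>V. \<forall>v\<in>V. E u v \<longleftrightarrow> u \<noteq> v \<and> S u \<inter> S v \<noteq> {}"
    using C unfolding in_class_C_def by (elim conjE exE) (rule that)
  note sys = bspec[OF sys']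
  have E: "E u v \<longleftrightarrow> u \<noteq> v \<and> S u \<inter> S v \<noteq> {}" if "u \<in> V" "v \<in> V" for u v
    by (rule bspec[OF bspec[OF E' that(1)] that(2)])
  show ?thesis
  proof (cases "\<exists>v. V \<subseteq> {v}")
    case True
    then show ?thesis using finite_cover_of_singleton b by auto
  next
    case False
    then obtain v0 where v0: "v0 \<in> V" by blast
    have reach_iff: "gdist V E u v \<le> real k \<longleftrightarrow> reach (meets V S) k u v" if "u \<in> V" "v \<in> V" for u v k
      by (rule gdist_reach[OF E conn that])
    have linked: "\<exists>n. reach (meets V S) n u v" if "u \<in> V" "v \<in> V" for u v
      using reach_iff[OF that] by (metis gdist_def order_refl)
    have ne: "S v \<noteq> {}" if v: "v \<in> V" for v
    proof
      assume empty: "S v = {}"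
      obtain u where u: "u \<in> V" "u \<noteq> v" using False by blast
      obtain n where "reach (meets V S) n v u" using linked[OF v u(1)] by blast
      then show False
      proof (rule reach_exit[of _ n v u "{v}"])
        fix x y assume "(x, y) \<in> meets V S" "x \<in> {v}"
        then show False using empty by (simp add: meets_def)
      qed (use u in auto)
    qed
    interpret hollow_system V K S \<alpha> v0
    proof unfold_locales
      fix v assume v: "v \<in> V"
      note s = sys[OF v]
      show "convex (K v)" "compact (K v)" "S v \<subseteq> K v" "connected (S v)"
        using s path_connected_imp_connected by auto
      show "diameter (K v) \<le> \<alpha> * height (K v)" using s by (simp add: aspect_ratio_le_def)
      show "frontier (K v) \<subseteq> S v" using s frontier_diff_interior by auto
      show "S v \<noteq> {}" by (rule ne[OF v])
    qed (use fin v0 \<alpha> linked in auto)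
    let ?r = "nat \<lceil>r\<rceil>"
    let ?D = "layered_bound (annulus_bound DIM('a) \<alpha>) (2 * DIM('a) + 2) ?r"
    have rpos: "?r > 0" using r by simp
    obtain T :: "nat \<Rightarrow> nat set" where T: "V = (\<Union>c\<le>2 * DIM('a) + 2. T c)"
      "\<And>c. c \<le> 2 * DIM('a) + 2 \<Longrightarrow> cbd ?r ?D (T c)"
      using hollow_cover[OF rpos] by blast
    define \<U> where "\<U> c = (\<lambda>x. {y. conn ?r (T c) x y}) ` T c" for c
    have "V = (\<Union>c\<le>2 * DIM('a) + 2. \<Union>(\<U> c))"
    proof -
      have "\<Union>(\<U> c) = T c" for c
        using conn_in conn_refl by (fastforce simp: \<U>_def)
      then show ?thesis using T(1) by simp
    qed
    moreover have "r_disjoint V E r (\<U> c) \<and> D_bounded V E b (\<U> c)" if c: "c \<le> 2 * DIM('a) + 2" for c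
    proof
      have TV: "T c \<subseteq> V" using T(1) c by blast
      show "D_bounded V E b (\<U> c)" unfolding D_bounded_def
      proof (intro ballI)
        fix U x y assume "U \<in> \<U> c" "x \<in> U" "y \<in> U"
        then obtain z where z: "conn ?r (T c) z x" "conn ?r (T c) z y" by (auto simp: \<U>_def)
        have xy: "conn ?r (T c) x y" using conn_trans[OF z(2) conn_sym[OF z(1)]] .
        then have "G ?D x y" using T(2)[OF c] by (simp add: cbd_def)
        moreover have "x \<in> V" "y \<in> V" using conn_in[OF xy] TV by auto
        ultimately have "gdist V E x y \<le> real ?D" using reach_iff by blast
        then show "gdist V E x y \<le> b" using b by simp
      qed
      show "r_disjoint V E r (\<U> c)" unfolding r_disjoint_def
      proof (intro ballI impI)
        fix U U' x y assume U: "U \<in> \<U> c" "U' \<in> \<U> c" "U \<noteq> U'" "x \<in> U" "y \<in> U'"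
        obtain u u' where u: "U = {y. conn ?r (T c) u y}" "U' = {y. conn ?r (T c) u' y}"
          using U by (auto simp: \<U>_def)
        have xu: "conn ?r (T c) u x" "conn ?r (T c) u' y" using U u by auto
        have V: "x \<in> T c" "y \<in> T c" "x \<in> V" "y \<in> V" using xu conn_in TV by blast+
        show "r < gdist V E x y"
        proof (rule ccontr)
          assume "\<not> r < gdist V E x y"
          then have "gdist V E x y \<le> real ?r" using r by linarith
          then have "G ?r x y" using reach_iff V by blast
          then have xy: "conn ?r (T c) x y" using V by (intro conn_edge)
          have uu: "conn ?r (T c) u u'"
            by (rule conn_trans[OF conn_sym[OF xu(2)] conn_trans[OF xy xu(1)]])
          have "U = U'" unfolding u
            using conn_trans[OF _ uu] conn_trans[OF _ conn_sym[OF uu]] by blast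
          then show False using U(3) by simp
        qed
      qed
    qed
    ultimately show ?thesis by blast
  qed
qed

theorem theorem5p5:
  fixes \<alpha> :: real
  assumes "\<alpha> \<ge> 1"
  shows "asdim_le (in_class_C TYPE('a::euclidean_space) \<alpha>) (2 * DIM('a) + 2)"
  unfolding asdim_le_def control_function_def
  \<comment> \<open>The summand 1 makes the control function positive.\<close>
  by (intro exI[of _ "\<lambda>r. real (layered_bound (annulus_bound DIM('a) \<alpha>) (2 * DIM('a) + 2) (nat \<lceil>r\<rceil>)) + 1"]
      conjI allI impI class_cover[OF _ assms _ refl]) simp_all

end
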